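(* Let $a\in K$ and assume the conjugacy class $\Delta(a)$ is $(\sigma,\delta)$-algebraic. Then a nonzero skew polynomial $P(T)\in K[T;\sigma,\delta]$ belongs to $S(a)$ if and only if $P(c)\neq0$ for all $c\in\Delta(a)$. In particular, $S(a)^{-1}K[T;\sigma,\delta]=Def(a)$.
   Context: Let $K$ be a skew field, $K^*=K\setminus\{0\}$, $\sigma\colon K\to K$ a ring endomorphism and $\delta\colon K\to K$ a $\sigma$-derivation. $R=K[T;\sigma,\delta]$ is the skew polynomial ring with $Ta=\sigma(a)T+\delta(a)$. The $(\sigma,\delta)$-action of $K^*$ on $K$ is ${}^{b}a=\sigma(b)ab^{-1}+\delta(b)b^{-1}$; $\Delta(a)=\{{}^{b}a:b\in K^*\}$. For $P\in R$, $P(a)$ is the unique element of $K$ with $P(T)-P(a)\in R(T-a)$. $\Delta(a)$ is $(\sigma,\delta)$-algebraic if some nonzero $P\in R$ satisfies $P(c)=0$ for all $c\in\Delta(a)$. For a set $Z$ with a $K^*$-action, the skew product of functions $Z\to K$ is $(f\diamond g)(z)=f({}^{g(z)}z)g(z)$ if $g(z)\neq0$, $0$ otherwise; $f$ is skew invertible if some $g$ satisfies $f\diamond g=g\diamond f=1$. $K(T;\sigma,\delta)$ is the division ring of left fractions of $R$; each $f$ has a unique minimal representation $P^{-1}Q$ with $P$ monic of least degree; $f$ is defined at $a$ if $c\mapsto P(c)$ on $\Delta(a)$ is skew invertible. $Def(a)$ is the set of skew rational functions defined at $a$. A left Ore subset of $R$ is a multiplicatively closed $S\subseteq R\setminus\{0\}$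 with $1\in S$ such that $Sr\cap Rs\neq\emptyset$ for all $s\in S,r\in R$. $S(a)$ is the unique left Ore subset of $R$ maximal among left Ore subsets $S$ such that for every $P\in S$ and every monic irreducible $Q$ with $P=Q_1QQ_2$ ($Q_1,Q_2\in R$), $Q^{-1}\in Def(a)$. *)

theory Defs
  imports Main
begin

text \<open>A skew polynomial is represented by its coefficient function
  nat => 'a (coefficient of T^n, polynomials written with coefficients on
  the left: P = sum p_n T^n), with finite support.\<close>

definition skew_polys :: "(nat \<Rightarrow> 'a::division_ring) set" where
  "skew_polys = {p. finite {n. p n \<noteq> 0}}"

definition ring_endo :: "('a::division_ring \<Rightarrow> 'a) \<Rightarrow> bool" where
  "ring_endo \<sigma> \<longleftrightarrow> \<sigma> 1 = 1 \<and> (\<forall>x y. \<sigma> (x + y) = \<sigma> x + \<sigma> y) \<and> (\<forall>x y. \<sigma> (x * y) = \<sigma> x * \<sigma> y)"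

definition sigma_derivation :: "('a::division_ring \<Rightarrow> 'a) \<Rightarrow> ('a \<Rightarrow> 'a) \<Rightarrow> bool" where
  "sigma_derivation \<sigma> \<delta> \<longleftrightarrow> (\<forall>x y. \<delta> (x + y) = \<delta> x + \<delta> y) \<and>
     (\<forall>x y. \<delta> (x * y) = \<sigma> x * \<delta> y + \<delta> x * y)"

definition spconst :: "'a::division_ring \<Rightarrow> nat \<Rightarrow> 'a" where
  "spconst c = (\<lambda>n. if n = 0 then c else 0)"

definition spone :: "nat \<Rightarrow> 'a::division_ring" where
  "spone = spconst 1"

definition spzero :: "nat \<Rightarrow> 'a::division_ring" where
  "spzero = (\<lambda>n. 0)"

definition spT :: "nat \<Rightarrow> 'a::division_ring" where
  "spT = (\<lambda>n. if n = 1 then 1 else 0)"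

definition spadd :: "(nat \<Rightarrow> 'a::division_ring) \<Rightarrow> (nat \<Rightarrow> 'a) \<Rightarrow> nat \<Rightarrow> 'a" where
  "spadd p q = (\<lambda>n. p n + q n)"

definition spsub :: "(nat \<Rightarrow> 'a::division_ring) \<Rightarrow> (nat \<Rightarrow> 'a) \<Rightarrow> nat \<Rightarrow> 'a" where
  "spsub p q = (\<lambda>n. p n - q n)"

text \<open>Left multiplication by T, using T a = sigma(a) T + delta(a).\<close>
definition Tmul :: "('a::division_ring \<Rightarrow> 'a) \<Rightarrow> ('a \<Rightarrow> 'a) \<Rightarrow> (nat \<Rightarrow> 'a) \<Rightarrow> nat \<Rightarrow> 'a" where
  "Tmul \<sigma> \<delta> p = (\<lambda>n. (if n = 0 then 0 else \<sigma> (p (n - 1))) + \<delta> (p n))"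

definition spmult :: "('a::division_ring \<Rightarrow> 'a) \<Rightarrow> ('a \<Rightarrow> 'a) \<Rightarrow> (nat \<Rightarrow> 'a) \<Rightarrow> (nat \<Rightarrow> 'a) \<Rightarrow> nat \<Rightarrow> 'a" where
  "spmult \<sigma> \<delta> p q = (\<lambda>n. \<Sum>i\<in>{i. p i \<noteq> 0}. p i * ((Tmul \<sigma> \<delta> ^^ i) q) n)"

definition spdeg :: "(nat \<Rightarrow> 'a::division_ring) \<Rightarrow> nat" where
  "spdeg p = (if {n. p n \<noteq> 0} = {} then 0 else Max {n. p n \<noteq> 0})"

definition spmonic :: "(nat \<Rightarrow> 'a::division_ring) \<Rightarrow> bool" where
  "spmonic p \<longleftrightarrow> p \<in> skew_polys \<and> p \<noteq> spzero \<and> p (spdeg p) = 1"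

definition speval :: "('a::division_ring \<Rightarrow> 'a) \<Rightarrow> ('a \<Rightarrow> 'a) \<Rightarrow> (nat \<Rightarrow> 'a) \<Rightarrow> 'a \<Rightarrow> 'a" where
  "speval \<sigma> \<delta> P a = (THE c. \<exists>Q\<in>skew_polys.
      spsub P (spconst c) = spmult \<sigma> \<delta> Q (spsub spT (spconst a)))"

definition sp_unit :: "('a::division_ring \<Rightarrow> 'a) \<Rightarrow> ('a \<Rightarrow> 'a) \<Rightarrow> (nat \<Rightarrow> 'a) \<Rightarrow> bool" where
  "sp_unit \<sigma> \<delta> U \<longleftrightarrow> U \<in> skew_polys \<and> (\<exists>V\<in>skew_polys.
      spmult \<sigma> \<delta> U V = spone \<and> spmult \<sigma> \<delta> V U = spone)"

definition sp_irreducible :: "('a::division_ring \<Rightarrow> 'a) \<Rightarrow> ('a \<Rightarrow> 'a) \<Rightarrow> (nat \<Rightarrow> 'a) \<Rightarrow> bool" where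
  "sp_irreducible \<sigma> \<delta> Q \<longleftrightarrow> Q \<in> skew_polys \<and> Q \<noteq> spzero \<and> \<not> sp_unit \<sigma> \<delta> Q \<and>
     (\<forall>A\<in>skew_polys. \<forall>B\<in>skew_polys. Q = spmult \<sigma> \<delta> A B \<longrightarrow> sp_unit \<sigma> \<delta> A \<or> sp_unit \<sigma> \<delta> B)"

definition sd_act :: "('a::division_ring \<Rightarrow> 'a) \<Rightarrow> ('a \<Rightarrow> 'a) \<Rightarrow> 'a \<Rightarrow> 'a \<Rightarrow> 'a" where
  "sd_act \<sigma> \<delta> b a = \<sigma> b * a * inverse b + \<delta> b * inverse b"

definition conj_class :: "('a::division_ring \<Rightarrow> 'a) \<Rightarrow> ('a \<Rightarrow> 'a) \<Rightarrow> 'a \<Rightarrow> 'a set" where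
  "conj_class \<sigma> \<delta> a = {sd_act \<sigma> \<delta> b a | b. b \<noteq> 0}"

definition sd_algebraic :: "('a::division_ring \<Rightarrow> 'a) \<Rightarrow> ('a \<Rightarrow> 'a) \<Rightarrow> 'a set \<Rightarrow> bool" where
  "sd_algebraic \<sigma> \<delta> D \<longleftrightarrow> (\<exists>P\<in>skew_polys. P \<noteq> spzero \<and> (\<forall>c\<in>D. speval \<sigma> \<delta> P c = 0))"

text \<open>Functions Z -> K are represented by functions 'a => 'a, considered on Z only.\<close>
definition skew_prod :: "('b \<Rightarrow> 'a::division_ring \<Rightarrow> 'b) \<Rightarrow> ('b \<Rightarrow> 'a) \<Rightarrow> ('b \<Rightarrow> 'a) \<Rightarrow> 'b \<Rightarrow> 'a" where
  "skew_prod act f g = (\<lambda>z. if g z \<noteq> 0 then f (act z (g z)) * g z else 0)"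

definition skew_invertible :: "'b set \<Rightarrow> ('b \<Rightarrow> 'a::division_ring \<Rightarrow> 'b) \<Rightarrow> ('b \<Rightarrow> 'a) \<Rightarrow> bool" where
  "skew_invertible Z act f \<longleftrightarrow> (\<exists>g. \<forall>z\<in>Z. skew_prod act f g z = 1 \<and> skew_prod act g f z = 1)"

text \<open>K(T;sigma,delta) is described (up to isomorphism over R) as a division ring 'd with
  an injective ring homomorphism iota from R such that every element is a left fraction
  (iota P)^-1 (iota Q).\<close>
definition left_frac_ring :: "('a::division_ring \<Rightarrow> 'a) \<Rightarrow> ('a \<Rightarrow> 'a) \<Rightarrow> ((nat \<Rightarrow> 'a) \<Rightarrow> 'd::division_ring) \<Rightarrow> bool" where
  "left_frac_ring \<sigma> \<delta> \<iota> \<longleftrightarrow> inj_on \<iota> skew_polys \<and> \<iota> spone = 1 \<and>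
     (\<forall>p\<in>skew_polys. \<forall>q\<in>skew_polys. \<iota> (spadd p q) = \<iota> p + \<iota> q \<and> \<iota> (spmult \<sigma> \<delta> p q) = \<iota> p * \<iota> q) \<and>
     (\<forall>f. \<exists>P\<in>skew_polys. \<exists>Q\<in>skew_polys. P \<noteq> spzero \<and> f = inverse (\<iota> P) * \<iota> Q)"

definition min_denom :: "((nat \<Rightarrow> 'a::division_ring) \<Rightarrow> 'd::division_ring) \<Rightarrow> 'd \<Rightarrow> nat \<Rightarrow> 'a" where
  "min_denom \<iota> f = (THE P. spmonic P \<and> (\<exists>Q\<in>skew_polys. f = inverse (\<iota> P) * \<iota> Q) \<and>
      (\<forall>P'. spmonic P' \<and> (\<exists>Q\<in>skew_polys. f = inverse (\<iota> P') * \<iota> Q) \<longrightarrow> spdeg P \<le> spdeg P'))"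

definition defined_at :: "('a::division_ring \<Rightarrow> 'a) \<Rightarrow> ('a \<Rightarrow> 'a) \<Rightarrow> ((nat \<Rightarrow> 'a) \<Rightarrow> 'd::division_ring) \<Rightarrow> 'd \<Rightarrow> 'a \<Rightarrow> bool" where
  "defined_at \<sigma> \<delta> \<iota> f a \<longleftrightarrow>
     skew_invertible (conj_class \<sigma> \<delta> a) (\<lambda>z b. sd_act \<sigma> \<delta> b z) (\<lambda>c. speval \<sigma> \<delta> (min_denom \<iota> f) c)"

definition Def_at :: "('a::division_ring \<Rightarrow> 'a) \<Rightarrow> ('a \<Rightarrow> 'a) \<Rightarrow> ((nat \<Rightarrow> 'a) \<Rightarrow> 'd::division_ring) \<Rightarrow> 'a \<Rightarrow> 'd set" where
  "Def_at \<sigma> \<delta> \<iota> a = {f. defined_at \<sigma> \<delta> \<iota> f a}"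

definition left_ore :: "('a::division_ring \<Rightarrow> 'a) \<Rightarrow> ('a \<Rightarrow> 'a) \<Rightarrow> (nat \<Rightarrow> 'a) set \<Rightarrow> bool" where
  "left_ore \<sigma> \<delta> S \<longleftrightarrow> S \<subseteq> skew_polys - {spzero} \<and> spone \<in> S \<and>
     (\<forall>s\<in>S. \<forall>t\<in>S. spmult \<sigma> \<delta> s t \<in> S) \<and>
     (\<forall>s\<in>S. \<forall>r\<in>skew_polys. \<exists>s'\<in>S. \<exists>r'\<in>skew_polys. spmult \<sigma> \<delta> s' r = spmult \<sigma> \<delta> r' s)"

definition good_for :: "('a::division_ring \<Rightarrow> 'a) \<Rightarrow> ('a \<Rightarrow> 'a) \<Rightarrow> ((nat \<Rightarrow> 'a) \<Rightarrow> 'd::division_ring) \<Rightarrow> 'a \<Rightarrow> (nat \<Rightarrow> 'a) set \<Rightarrow> bool" where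
  "good_for \<sigma> \<delta> \<iota> a S \<longleftrightarrow> (\<forall>P\<in>S. \<forall>Q. spmonic Q \<and> sp_irreducible \<sigma> \<delta> Q \<and>
      (\<exists>Q1\<in>skew_polys. \<exists>Q2\<in>skew_polys. P = spmult \<sigma> \<delta> (spmult \<sigma> \<delta> Q1 Q) Q2)
      \<longrightarrow> inverse (\<iota> Q) \<in> Def_at \<sigma> \<delta> \<iota> a)"

definition S_at :: "('a::division_ring \<Rightarrow> 'a) \<Rightarrow> ('a \<Rightarrow> 'a) \<Rightarrow> ((nat \<Rightarrow> 'a) \<Rightarrow> 'd::division_ring) \<Rightarrow> 'a \<Rightarrow> (nat \<Rightarrow> 'a) set" where
  "S_at \<sigma> \<delta> \<iota> a = (THE S. left_ore \<sigma> \<delta> S \<and> good_for \<sigma> \<delta> \<iota> a S \<and>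
      (\<forall>S'. left_ore \<sigma> \<delta> S' \<and> good_for \<sigma> \<delta> \<iota> a S' \<and> S \<subseteq> S' \<longrightarrow> S' = S))"

end

theory Submission
  imports Defs
begin

text \<open>Let \<open>R\<close> act on \<open>K = R / R (T - a)\<close>; then \<open>P x = P({}\<^sup>x a) x\<close> for \<open>x \<noteq> 0\<close>, so \<open>P\<close> has no zero on
  \<open>\<Delta>(a)\<close> iff \<open>P\<close> acts injectively, and \<open>P\<close> is skew invertible on \<open>\<Delta>(a)\<close> iff it acts bijectively.
  If \<open>\<Delta>(a)\<close> is algebraic, then \<open>K\<close> is finite-dimensional over the centralizer of \<open>a\<close>, so the two
  conditions agree.  The annihilator of \<open>K\<close> is a two-sided ideal \<open>R M\<close>, and the \<open>P\<close> acting
  injectively are those with \<open>R P + R M = R\<close>; normality of \<open>M\<close> and a degree count show that they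
  form a left Ore set.  It contains every admissible Ore set because a zero \<open>c \<in> \<Delta>(a)\<close> of \<open>P\<close>
  gives the irreducible right factor \<open>T - c\<close>.

  All computations with skew polynomials take place in the division ring of fractions, where the
  type class laws are available.\<close>

section \<open>Left Euclidean subrings of division rings\<close>

text \<open>The quotient stands to the left of the divisor, which skew polynomials allow for every
  \<sigma>. Hence left ideals are principal, and divisibility below is by right factors.\<close>

locale left_euclidean_subring =
  fixes R :: "'d::division_ring set" and deg :: "'d \<Rightarrow> nat"
  assumes one_closed: "1 \<in> R"
    and diff_closed: "x \<in> R \<Longrightarrow> y \<in> R \<Longrightarrow> x - y \<in> R"
    and mult_closed: "x \<in> R \<Longrightarrow> y \<in> R \<Longrightarrow> x * y \<in> R"
    and deg_mult: "x \<in> R \<Longrightarrow> y \<in> R \<Longrightarrow> x \<noteq> 0 \<Longrightarrow> y \<noteq> 0 \<Longrightarrow> deg (x * y) = deg x + deg y"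
    and division: "r \<in> R \<Longrightarrow> s \<in> R \<Longrightarrow> s \<noteq> 0 \<Longrightarrow>
      \<exists>q\<in>R. \<exists>t\<in>R. r = q * s + t \<and> (t = 0 \<or> deg t < deg s)"
begin

section \<open>Right factors and principal left ideals\<close>

definition rdvd :: "'d \<Rightarrow> 'd \<Rightarrow> bool" where
  "rdvd s x \<longleftrightarrow> (\<exists>q\<in>R. x = q * s)"

lemma zero_closed: "0 \<in> R"
  using diff_closed[OF one_closed one_closed] by simp

lemma uminus_closed: "x \<in> R \<Longrightarrow> - x \<in> R"
  using diff_closed[OF zero_closed] by simp

lemma add_closed: "x \<in> R \<Longrightarrow> y \<in> R \<Longrightarrow> x + y \<in> R"
  using diff_closed[of x "- y"] uminus_closed by simp

lemmas closed = one_closed zero_closed uminus_closed add_closed diff_closed mult_closed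

lemma rdvdI: "q \<in> R \<Longrightarrow> x = q * s \<Longrightarrow> rdvd s x"
  unfolding rdvd_def by blast

lemma rdvdE:
  assumes "rdvd s x"
  obtains q where "q \<in> R" "x = q * s"
  using assms unfolding rdvd_def by blast

lemma rdvd_refl: "rdvd s s"
  by (rule rdvdI[OF one_closed]) simp

lemma rdvd_mult: "rdvd s x \<Longrightarrow> r \<in> R \<Longrightarrow> rdvd s (r * x)"
  by (elim rdvdE, rule rdvdI[of "r * _"]) (auto simp: closed mult.assoc)

lemma rdvd_add: "rdvd s x \<Longrightarrow> rdvd s y \<Longrightarrow> rdvd s (x + y)"
  unfolding rdvd_def using add_closed by (metis distrib_right)

lemma rdvd_diff: "rdvd s x \<Longrightarrow> rdvd s y \<Longrightarrow> rdvd s (x - y)"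
  unfolding rdvd_def using diff_closed by (metis left_diff_distrib)

lemma rdvd_trans: "rdvd s t \<Longrightarrow> rdvd t x \<Longrightarrow> rdvd s x"
  unfolding rdvd_def using mult_closed by (metis mult.assoc)

lemma rdvd_deg_le:
  assumes "rdvd s x" "s \<in> R" "x \<noteq> 0"
  shows "deg s \<le> deg x"
proof -
  obtain q where "q \<in> R" "x = q * s"
    using assms(1) by (rule rdvdE)
  then show ?thesis
    using deg_mult[of q s] assms by auto
qed

text \<open>Division of 1 by such an element leaves no nonzero remainder, so the quotient is its
  inverse.\<close>

lemma deg_zero_unit:
  assumes "s \<in> R" "s \<noteq> 0" "deg s = 0"
  shows "inverse s \<in> R"
proof -
  obtain q where q: "q \<in> R" "1 = q * s"
    using division[OF one_closed assms(1,2)] assms(3) by auto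
  then have "inverse s = q"
    by (metis assms(2) mult.assoc mult_1_left mult_1_right right_inverse)
  with q show ?thesis by simp
qed

lemma deg_one: "deg 1 = 0"
  using deg_mult[OF one_closed one_closed] by simp

text \<open>The cofactor has degree zero and is a unit of \<open>R\<close>, so both elements
  generate the same left ideal.\<close>

lemma rdvd_deg_eq_sym:
  assumes "rdvd s x" "s \<in> R" "x \<noteq> 0" "deg x = deg s"
  shows "rdvd x s"
proof -
  obtain q where q: "q \<in> R" "x = q * s"
    using assms(1) by (rule rdvdE)
  then have nz: "q \<noteq> 0" "s \<noteq> 0"
    using assms(3) by auto
  then have "deg q = 0"
    using deg_mult[of q s] q assms by auto
  then have "inverse q \<in> R"
    using q nz deg_zero_unit by blast
  moreover have "s = inverse q * x"
    using q nz by (simp add: mult.assoc[symmetric])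
  ultimately show ?thesis
    by (rule rdvdI)
qed

text \<open>An element of least degree generates: remainders modulo it stay in the ideal and have
  smaller degree.\<close>

lemma left_ideal_principal:
  assumes "I \<subseteq> R" "\<And>x y. x \<in> I \<Longrightarrow> y \<in> I \<Longrightarrow> x - y \<in> I"
    and "\<And>x r. x \<in> I \<Longrightarrow> r \<in> R \<Longrightarrow> r * x \<in> I" and "x \<in> I" "x \<noteq> 0"
  obtains d where "d \<in> I" "d \<noteq> 0" "\<And>y. y \<in> I \<Longrightarrow> rdvd d y"
proof -
  obtain d where d: "d \<in> I" "d \<noteq> 0" "\<And>y. y \<in> I \<and> y \<noteq> 0 \<Longrightarrow> deg d \<le> deg y"
    using ex_has_least_nat[of "\<lambda>y. y \<in> I \<and> y \<noteq> 0" x deg] assms(4,5) by blast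
  have "rdvd d y" if y: "y \<in> I" for y
  proof -
    obtain q t where qt: "q \<in> R" "t \<in> R" "y = q * d + t" "t = 0 \<or> deg t < deg d"
      using division[of y d] y d(1,2) assms(1) by (metis subsetD)
    have "y - q * d \<in> I"
      using assms(2,3) y d(1) qt(1) by blast
    then have "t \<in> I"
      using qt(3) by simp
    then have "t = 0"
      using qt(4) d(3)[of t] by linarith
    then show ?thesis
      using qt by (intro rdvdI) auto
  qed
  with d show thesis
    by (intro that) auto
qed

text \<open>The generator \<open>s'\<close> of the left ideal \<open>(R s : r)\<close> satisfies \<open>lclm r s = s' r\<close>, so the degree
  equation is \<open>deg (lclm r s) + deg (gcrd r s) = deg r + deg s\<close>.  Proving it along the Euclidean
  algorithm avoids dimension counts over a skew field.\<close>
lemma gcrd_lclm: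
  assumes "r \<in> R" "s \<in> R" "s \<noteq> 0"
  shows "\<exists>d\<in>R. \<exists>s'\<in>R. \<exists>\<alpha>\<in>R. \<exists>\<beta>\<in>R. d \<noteq> 0 \<and> s' \<noteq> 0 \<and> d = \<alpha> * r + \<beta> * s \<and> rdvd d r \<and> rdvd d s \<and>
    deg s' + deg d = deg s \<and> (\<forall>v\<in>R. rdvd s (v * r) \<longleftrightarrow> rdvd s' v)"
  using assms
proof (induction "deg s" arbitrary: r s rule: less_induct)
  case less
  obtain q t where qt: "q \<in> R" "t \<in> R" "r = q * s + t" "t = 0 \<or> deg t < deg s"
    using division[OF less.prems] by blast
  show ?case
  proof (cases "t = 0")
    case True
    \<comment> \<open>Here \<open>s\<close> right-divides \<open>r\<close>, so \<open>d = s\<close>,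
      and (R s : r) is all of \<open>R\<close>, generated by 1.\<close>
    have "s = 0 * r + 1 * s"
      by simp
    moreover have "rdvd s r"
      using qt True by (intro rdvdI[of q]) auto
    moreover have "rdvd s (v * r) \<longleftrightarrow> rdvd 1 v" if "v \<in> R" for v
      using rdvd_mult[OF \<open>rdvd s r\<close> that] that rdvdI[of v v 1] by simp
    ultimately show ?thesis
      using less.prems one_closed zero_closed deg_one rdvd_refl
      by (intro bexI[of _ s] bexI[of _ 1] bexI[of _ 0] bexI[of _ 1]) (auto simp: mult.assoc)
  next
    case False
    obtain d t' \<alpha> \<beta> where IH: "d \<in> R" "t' \<in> R" "\<alpha> \<in> R" "\<beta> \<in> R" "d \<noteq> 0" "t' \<noteq> 0"
      "d = \<alpha> * s + \<beta> * t" "rdvd d s" "rdvd d t" "deg t' + deg d = deg t"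
      "\<And>v. v \<in> R \<Longrightarrow> rdvd t (v * s) \<longleftrightarrow> rdvd t' v"
      using less.hyps[of t s] qt False less.prems by blast
    \<comment> \<open>As r and t agree modulo R s, the ideals (R s : r) and (R s : t) coincide. The
      least common left multiple t' s = s' t makes \<open>s'\<close> a generator of the
      latter.\<close>
    have "rdvd t (t' * s)"
      using IH(11)[OF IH(2)] rdvd_refl by blast
    then obtain s' where s': "s' \<in> R" "t' * s = s' * t"
      by (rule rdvdE)
    have s'0: "s' \<noteq> 0"
      using s'(2) IH(6) less.prems(3) by auto
    have "deg t' + deg s = deg s' + deg t"
      using deg_mult[of t' s] deg_mult[of s' t] s' s'0 IH False less.prems qt by simp
    then have deg: "deg s' + deg d = deg s"
      using IH(10) by simp
    have gen: "rdvd s (v * r) \<longleftrightarrow> rdvd s' v" if v: "v \<in> R" for v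
    proof
      assume "rdvd s (v * r)"
      then have "rdvd s (v * r - (v * q) * s)"
        using v qt rdvd_refl rdvd_mult mult_closed rdvd_diff by blast
      then have "rdvd s (v * t)"
        using qt(3) by (simp add: distrib_left mult.assoc)
      then obtain w where w: "w \<in> R" "v * t = w * s"
        by (rule rdvdE)
      then have "rdvd t (w * s)"
        using v rdvdI by metis
      then obtain k where k: "k \<in> R" "w = k * t'"
        using IH(11) w rdvdE by metis
      have "v * t = (k * s') * t"
        using w k s' by (simp add: mult.assoc)
      then have "v = k * s'"
        using False by simp
      then show "rdvd s' v"
        using k rdvdI by blast
    next
      assume "rdvd s' v"
      then obtain k where k: "k \<in> R" "v = k * s'"
        by (rule rdvdE)
      have "v * r = (v * q + k * t') * s"
        using k s'(2) qt(3) by (simp add: distrib_left distrib_right mult.assoc)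
      then show "rdvd s (v * r)"
        using v k qt IH closed by (intro rdvdI[of "v * q + k * t'"]) auto
    qed
    have "d = \<beta> * r + (\<alpha> - \<beta> * q) * s"
      using IH(7) qt(3) by (simp add: distrib_left left_diff_distrib mult.assoc)
    moreover have "rdvd d r"
      using IH qt rdvd_add rdvd_mult by blast
    moreover have "\<alpha> - \<beta> * q \<in> R"
      using IH(3,4) qt(1) by (simp add: closed)
    ultimately show ?thesis
      using IH(1,3,4,5,8) s' s'0 deg gen
      by (intro bexI[of _ d] bexI[of _ s'] bexI[of _ \<beta>] bexI[of _ "\<alpha> - \<beta> * q"]) simp_all
  qed
qed

section \<open>Right coprimality and the Ore condition\<close>

definition coprime_right :: "'d \<Rightarrow> 'd \<Rightarrow> bool" where
  "coprime_right r s \<longleftrightarrow> (\<exists>\<alpha>\<in>R. \<exists>\<beta>\<in>R. 1 = \<alpha> * r + \<beta> * s)"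

lemma coprime_right_if_deg_zero:
  assumes "d \<in> R" "d \<noteq> 0" "deg d = 0" "d = \<alpha> * r + \<beta> * s" "\<alpha> \<in> R" "\<beta> \<in> R"
  shows "coprime_right r s"
proof -
  have i: "inverse d \<in> R"
    using assms deg_zero_unit by blast
  have "1 = inverse d * d"
    using assms by simp
  also have "\<dots> = (inverse d * \<alpha>) * r + (inverse d * \<beta>) * s"
    unfolding assms(4) by (simp only: distrib_left mult.assoc)
  finally show ?thesis
    unfolding coprime_right_def using i assms mult_closed by blast
qed

text \<open>By the Bezout identity a common right divisor divides 1.\<close>

lemma coprime_right_rdvd_deg:
  assumes "coprime_right r s" "rdvd d r" "rdvd d s" "d \<in> R"
  shows "deg d = 0"
proof -
  obtain \<alpha> \<beta> where "\<alpha> \<in> R" "\<beta> \<in> R" and eq: "1 = \<alpha> * r + \<beta> * s"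
    using assms(1) unfolding coprime_right_def by blast
  then have "rdvd d (\<alpha> * r + \<beta> * s)"
    using assms(2,3) by (intro rdvd_add rdvd_mult)
  then show ?thesis
    using rdvd_deg_le[of d 1] assms(4) deg_one unfolding eq[symmetric] by simp
qed

text \<open>If \<open>R M\<close> is two-sided, then \<open>\<phi> r = M r M\<inverse>\<close> is a degree-preserving endomorphism of \<open>R\<close>,
  and \<open>s\<close> is right coprime to \<open>M\<close> exactly when \<open>M s = \<phi> s M\<close> is a least common left multiple.\<close>
lemma coprime_right_ore:
  assumes M: "M \<in> R" "M \<noteq> 0" and normal: "\<And>r. r \<in> R \<Longrightarrow> rdvd M (M * r)"
    and s: "s \<in> R" "s \<noteq> 0" and cop: "coprime_right M s" and r: "r \<in> R"
  shows "\<exists>s'\<in>R. s' \<noteq> 0 \<and> coprime_right M s' \<and> rdvd s (s' * r)"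
proof -
  define \<phi> where "\<phi> x = M * x * inverse M" for x
  have \<phi>M: "\<phi> x * M = M * x" for x
    unfolding \<phi>_def using M by (simp add: mult.assoc)
  have \<phi>R: "\<phi> x \<in> R" if x: "x \<in> R" for x
  proof -
    obtain q where "q \<in> R" "M * x = q * M"
      using normal[OF x] by (rule rdvdE)
    then show ?thesis
      unfolding \<phi>_def using M by (simp add: mult.assoc)
  qed
  have \<phi>0: "\<phi> x \<noteq> 0" if "x \<noteq> 0" for x
    unfolding \<phi>_def using that M by simp
  have \<phi>deg: "deg (\<phi> x) = deg x" if "x \<in> R" "x \<noteq> 0" for x
    using deg_mult[of "\<phi> x" M] deg_mult[of M x] \<phi>M[of x] that M \<phi>R \<phi>0 by simp
  have \<phi>mult: "\<phi> (x * y) = \<phi> x * \<phi> y" for x y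
    unfolding \<phi>_def using M by (simp add: mult.assoc) (simp add: mult.assoc[symmetric])
  have \<phi>add: "\<phi> (x + y) = \<phi> x + \<phi> y" for x y
    unfolding \<phi>_def by (simp add: distrib_left distrib_right)
  \<comment> \<open>The candidate is the generator \<open>s'\<close> of (R s : r); the goal is that
    the common right divisor \<open>e\<close> of \<open>M\<close> and \<open>s'\<close> has degree
    zero. Likewise \<open>u\<close>, \<open>ss\<close> and \<open>s2\<close> generate (R s' : M), (R
    s : M) and (R \<phi>(s) : \<phi>(r)).\<close>
  obtain d s' \<alpha> \<beta> where 1: "d \<in> R" "s' \<in> R" "\<alpha> \<in> R" "\<beta> \<in> R" "d \<noteq> 0" "s' \<noteq> 0"
    "d = \<alpha> * r + \<beta> * s" "deg s' + deg d = deg s"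
    "\<And>v. v \<in> R \<Longrightarrow> rdvd s (v * r) \<longleftrightarrow> rdvd s' v"
    using gcrd_lclm[OF r s] by metis
  obtain e u \<alpha>' \<beta>' where 2: "e \<in> R" "u \<in> R" "\<alpha>' \<in> R" "\<beta>' \<in> R" "e \<noteq> 0" "u \<noteq> 0"
    "e = \<alpha>' * M + \<beta>' * s'" "deg u + deg e = deg s'"
    "\<And>v. v \<in> R \<Longrightarrow> rdvd s' (v * M) \<longleftrightarrow> rdvd u v"
    using gcrd_lclm[OF M(1) 1(2,6)] by metis
  obtain g ss where 3: "g \<in> R" "ss \<in> R" "ss \<noteq> 0" "rdvd g M" "rdvd g s" "deg ss + deg g = deg s"
    "\<And>v. v \<in> R \<Longrightarrow> rdvd s (v * M) \<longleftrightarrow> rdvd ss v"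
    using gcrd_lclm[OF M(1) s] by metis
  obtain d2 s2 where 4: "d2 \<in> R" "s2 \<in> R" "s2 \<noteq> 0" "rdvd d2 (\<phi> r)" "rdvd d2 (\<phi> s)"
    "deg s2 + deg d2 = deg (\<phi> s)" "\<And>v. v \<in> R \<Longrightarrow> rdvd (\<phi> s) (v * \<phi> r) \<longleftrightarrow> rdvd s2 v"
    using gcrd_lclm[OF \<phi>R[OF r] \<phi>R[OF s(1)] \<phi>0[OF s(2)]] by metis
  \<comment> \<open>Coprimality gives \<open>deg ss = deg s\<close>. Since \<phi>(s) M = M s lies in
    R s, \<open>ss\<close> divides \<open>\<phi> s\<close>, and equal degrees give R ss = R
    \<phi>(s).\<close>
  have "deg g = 0"
    using coprime_right_rdvd_deg[OF cop] 3 by blast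
  then have "deg ss = deg s"
    using 3 by simp
  moreover have "rdvd ss (\<phi> s)"
    using 3(7)[OF \<phi>R[OF s(1)]] \<phi>M[of s] M rdvd_refl rdvd_mult by metis
  ultimately have ss: "rdvd (\<phi> s) ss"
    using rdvd_deg_eq_sym 3 \<phi>deg \<phi>0 s by metis
  \<comment> \<open>Since u M lies in R s', the element u M r = u \<phi>(r) M lies in R s. So u
    \<phi>(r) lies in R \<phi>(s), and \<open>s2\<close> divides \<open>u\<close>.\<close>
  have "rdvd s' (u * M)"
    using 2(2,9) rdvd_refl by blast
  then obtain w where w: "w \<in> R" "u * M = w * s'"
    by (rule rdvdE)
  have "rdvd s (s' * r)"
    using 1(2,9) rdvd_refl by blast
  then have "rdvd s (u * M * r)"
    using w rdvd_mult by (metis mult.assoc)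
  then have "rdvd s ((u * \<phi> r) * M)"
    using \<phi>M by (metis mult.assoc)
  then have "rdvd (\<phi> s) (u * \<phi> r)"
    using 3(7) 2(2) \<phi>R[OF r] ss mult_closed rdvd_trans by blast
  then have "rdvd s2 u"
    using 4(7) 2(2) by blast
  then have "deg s2 \<le> deg u"
    using rdvd_deg_le 4 2 by blast
  \<comment> \<open>\<phi> carries the Bezout identity of \<open>d\<close> to one for
    \<open>\<phi> d\<close>, which \<open>d2\<close> therefore divides. The degree equations then
    give deg u >= deg s2 >= deg s', which forces \<open>deg e = 0\<close>.\<close>
  moreover have "deg d2 \<le> deg d"
  proof -
    have "\<phi> d = \<phi> \<alpha> * \<phi> r + \<phi> \<beta> * \<phi> s"
      using 1(7) \<phi>add \<phi>mult by metis
    then have "rdvd d2 (\<phi> d)"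
      using 4(4,5) rdvd_add rdvd_mult \<phi>R 1(3,4) by metis
    then show ?thesis
      using rdvd_deg_le 4(1) \<phi>0[OF 1(5)] \<phi>deg 1 by metis
  qed
  ultimately have "deg e = 0"
    using 1(8) 2(8) 4(6) \<phi>deg[OF s] by simp
  then have "coprime_right M s'"
    using coprime_right_if_deg_zero 2 by blast
  then show ?thesis
    using 1(2,6) \<open>rdvd s (s' * r)\<close> by blast
qed

end

section \<open>Actions with an annihilator\<close>

text \<open>\<open>L\<close> is the action of \<open>R\<close> on the module \<open>R / R (T - a)\<close>, whose underlying set is \<open>K\<close>.
  The element \<open>t\<close> in the last assumption is \<open>T - b\<close> with \<open>b\<close> the conjugate of \<open>a\<close> by \<open>u\<close>.\<close>
locale euclidean_action = left_euclidean_subring R deg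
  for R :: "'d::division_ring set" and deg :: "'d \<Rightarrow> nat" +
  fixes L :: "'d \<Rightarrow> 'a::division_ring \<Rightarrow> 'a" and C :: "'a set"
  assumes L_one: "L 1 x = x"
    and L_add: "f \<in> R \<Longrightarrow> g \<in> R \<Longrightarrow> L (f + g) x = L f x + L g x"
    and L_mult: "f \<in> R \<Longrightarrow> g \<in> R \<Longrightarrow> L (f * g) x = L f (L g x)"
    and L_add_right: "f \<in> R \<Longrightarrow> L f (x + y) = L f x + L f y"
    and L_C: "f \<in> R \<Longrightarrow> c \<in> C \<Longrightarrow> L f (x * c) = L f x * c"
    and linear_annihilator: "u \<noteq> 0 \<Longrightarrow> \<exists>t\<in>R. deg t = 1 \<and> t \<noteq> 0 \<and>
      (\<forall>y. L t y = 0 \<longrightarrow> (\<exists>c\<in>C. y = u * c)) \<and> (\<forall>f\<in>R. L f u = 0 \<longleftrightarrow> rdvd t f)"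
begin

lemma L_zero_right: "f \<in> R \<Longrightarrow> L f 0 = 0"
  using L_add_right[of f 0 0] by simp

lemma L_diff_right: "f \<in> R \<Longrightarrow> L f (x - y) = L f x - L f y"
  using L_add_right[of f "x - y" y] by (simp add: algebra_simps)

lemma L_zero: "L 0 x = 0"
  using L_add[OF zero_closed zero_closed] by simp

lemma inj_L_iff: "f \<in> R \<Longrightarrow> inj (L f) \<longleftrightarrow> (\<forall>x. L f x = 0 \<longrightarrow> x = 0)"
  unfolding inj_def by (metis L_diff_right L_zero_right diff_self eq_iff_diff_eq_0)

lemma inj_L_rdvd:
  assumes "rdvd g f" "g \<in> R" "inj (L f)"
  shows "inj (L g)"
proof -
  obtain q where "q \<in> R" "f = q * g"
    using assms(1) by (rule rdvdE)
  then show ?thesis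
    using assms inj_L_iff L_mult L_zero_right mult_closed by metis
qed

section \<open>Wedderburn elements and their kernels\<close>

definition kernel :: "'d \<Rightarrow> 'a set" where
  "kernel N = {x. L N x = 0}"

text \<open>The Wedderburn polynomials of Lam and Leroy.\<close>
definition wedderburn :: "'d \<Rightarrow> bool" where
  "wedderburn N \<longleftrightarrow> N \<in> R \<and> N \<noteq> 0 \<and> (\<forall>f\<in>R. (\<forall>x\<in>kernel N. L f x = 0) \<longrightarrow> rdvd N f)"

text \<open>Multiply \<open>N\<close> on the left by the linear element that kills
  \<open>u = L N x\<close>. The kernel grows by the line x C and the degree by one, so the degree
  stands in for the dimension of the kernel over \<open>C\<close>.\<close>

lemma wedderburn_extend:
  assumes N: "wedderburn N" and x: "x \<notin> kernel N"
  shows "\<exists>N'. wedderburn N' \<and> deg N' = Suc (deg N) \<and>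
    kernel N' = {y + x * c | y c. y \<in> kernel N \<and> c \<in> C}"
proof -
  define u where "u = L N x"
  have u: "u \<noteq> 0"
    using x unfolding kernel_def u_def by simp
  have NR: "N \<in> R" "N \<noteq> 0"
    using N unfolding wedderburn_def by auto
  obtain t where t: "t \<in> R" "deg t = 1" "t \<noteq> 0" "\<And>y. L t y = 0 \<Longrightarrow> \<exists>c\<in>C. y = u * c"
    "\<And>f. f \<in> R \<Longrightarrow> L f u = 0 \<longleftrightarrow> rdvd t f"
    using linear_annihilator[OF u] by blast
  have tu: "L t u = 0"
    using t rdvd_refl by blast
  have ker: "kernel (t * N) = {y + x * c | y c. y \<in> kernel N \<and> c \<in> C}"
  proof (intro equalityI subsetI)
    fix z assume "z \<in> kernel (t * N)"
    then have "L t (L N z) = 0"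
      using L_mult[OF t(1) NR(1)] unfolding kernel_def by simp
    then obtain c where c: "c \<in> C" "L N z = u * c"
      using t(4) by blast
    then have "L N (z - x * c) = 0"
      using L_diff_right L_C NR unfolding u_def by simp
    then have "z = (z - x * c) + x * c \<and> z - x * c \<in> kernel N \<and> c \<in> C"
      using c unfolding kernel_def by simp
    then show "z \<in> {y + x * c | y c. y \<in> kernel N \<and> c \<in> C}"
      by blast
  next
    fix z assume "z \<in> {y + x * c | y c. y \<in> kernel N \<and> c \<in> C}"
    then obtain y c where "z = y + x * c" "y \<in> kernel N" "c \<in> C"
      by blast
    then show "z \<in> kernel (t * N)"
      using t(1) NR tu unfolding kernel_def u_def by (simp add: L_mult L_add_right L_C)
  qed
  \<comment> \<open>\<open>f\<close> vanishes on \<open>kernel N\<close>, so f = g N. Vanishing at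
    \<open>x\<close> too, it makes \<open>g\<close> kill \<open>u\<close>, so \<open>t\<close>
    right-divides \<open>g\<close>.\<close>
  have "rdvd (t * N) f" if f: "f \<in> R" and van: "\<forall>z\<in>kernel (t * N). L f z = 0" for f
  proof -
    have "kernel N \<subseteq> kernel (t * N)"
      using t NR L_zero_right unfolding kernel_def by (auto simp: L_mult)
    then have "rdvd N f"
      using N f van unfolding wedderburn_def by blast
    then obtain g where g: "g \<in> R" "f = g * N"
      by (rule rdvdE)
    have "x \<in> kernel (t * N)"
      using tu t NR unfolding kernel_def u_def by (simp add: L_mult)
    then have "L g u = 0"
      using van g NR unfolding u_def by (simp add: L_mult)
    then obtain h where "h \<in> R" "g = h * t"
      using t(5) g rdvdE by blast
    then show ?thesis
      using g by (intro rdvdI[of h]) (auto simp: mult.assoc)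
  qed
  then have "wedderburn (t * N)"
    unfolding wedderburn_def using t NR mult_closed by simp
  moreover have "deg (t * N) = Suc (deg N)"
    using deg_mult t NR by simp
  ultimately show ?thesis
    using ker by blast
qed

lemma wedderburn_one: "wedderburn 1" "kernel 1 = {0}"
  unfolding wedderburn_def kernel_def by (auto simp: one_closed L_one intro: rdvdI)

context
  fixes A
  assumes A: "A \<in> R" "A \<noteq> 0" and ann: "\<And>x. L A x = 0"
begin

text \<open>\<open>A\<close> vanishes on every kernel and so lies in R N. This bound takes the place
  of finite dimension.\<close>

lemma wedderburn_deg_le: "wedderburn N \<Longrightarrow> deg N \<le> deg A"
  using A ann rdvd_deg_le unfolding wedderburn_def by blast

text \<open>A linear-algebra-free form of ``injective endomorphisms of a finite-dimensional space are
  surjective'': \<open>L P\<close> carries kernels of Wedderburn elements to kernels of Wedderburn elements of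
  the same degree.\<close>
lemma inj_L_surj:
  assumes P: "P \<in> R" and inj: "inj (L P)"
  shows "\<exists>M. wedderburn M \<and> kernel M = UNIV" "surj (L P)"
proof -
  \<comment> \<open>A good pair describes a subspace and its image under \<open>L P\<close>, both
    cut out by Wedderburn elements of one degree. Starting from the zero spaces, a pair of largest
    degree is taken.\<close>
  define good where "good = (\<lambda>p. wedderburn (fst p) \<and> wedderburn (snd p) \<and> deg (fst p) = deg (snd p) \<and>
      kernel (snd p) = L P ` kernel (fst p))"
  have "good (1, 1)"
    unfolding good_def using wedderburn_one L_zero_right P by simp
  moreover have "\<forall>p. good p \<longrightarrow> deg (fst p) < Suc (deg A)"
    using wedderburn_deg_le unfolding good_def by (simp add: less_Suc_eq_le)
  ultimately obtain p where p: "good p" "\<And>q. good q \<Longrightarrow> deg (fst q) \<le> deg (fst p)"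
    using ex_has_greatest_nat[of good "(1,1)" "\<lambda>p. deg (fst p)"] by blast
  obtain N N' where NN: "p = (N, N')"
    by (cases p)
  have N: "wedderburn N" "wedderburn N'" "deg N = deg N'" "kernel N' = L P ` kernel N"
    using p(1) NN unfolding good_def by auto
  \<comment> \<open>A point outside the kernel would enlarge both members of the pair: injectivity
    keeps its image outside \<open>kernel N'\<close>.\<close>
  have full: "kernel N = UNIV"
  proof (rule ccontr)
    assume "kernel N \<noteq> UNIV"
    then obtain x where x: "x \<notin> kernel N"
      by blast
    then have "L P x \<notin> kernel N'"
      using N(4) inj by (auto simp: inj_def)
    then obtain N1' where 2: "wedderburn N1'" "deg N1' = Suc (deg N')"
        "kernel N1' = {y + L P x * c | y c. y \<in> kernel N' \<and> c \<in> C}"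
      using wedderburn_extend[OF N(2)] by blast
    obtain N1 where
      1: "wedderburn N1" "deg N1 = Suc (deg N)" "kernel N1 = {y + x * c | y c. y \<in> kernel N \<and> c \<in> C}"
      using wedderburn_extend[OF N(1) x] by blast
    have "kernel N1' = L P ` kernel N1"
      unfolding 1 2 N(4) by (fastforce simp: L_add_right[OF P] L_C[OF P] image_iff)
    then have "good (N1, N1')"
      unfolding good_def using 1 2 N by simp
    then show False
      using p(2) 1 NN by fastforce
  qed
  \<comment> \<open>Now \<open>N\<close> annihilates the whole module, so \<open>N'\<close> divides
    it. Equal degrees make the two associates, so \<open>N'\<close> annihilates the whole module as
    well.\<close>
  have "rdvd N' N"
    using N(1,2) full unfolding wedderburn_def kernel_def by blast
  then have "rdvd N N'"
    using rdvd_deg_eq_sym N unfolding wedderburn_def by metis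
  then obtain q where "q \<in> R" "N' = q * N"
    by (rule rdvdE)
  then have "kernel N' = UNIV"
    using full N(1) L_zero_right unfolding kernel_def wedderburn_def by (auto simp: L_mult set_eq_iff)
  then show "surj (L P)"
    using N(4) by blast
  show "\<exists>M. wedderburn M \<and> kernel M = UNIV"
    using N(1) full by blast
qed

lemma bij_L_iff_inj: "P \<in> R \<Longrightarrow> bij (L P) \<longleftrightarrow> inj (L P)"
  using inj_L_surj(2)[of P] by (auto simp: bij_def)

text \<open>Acting injectively amounts to right coprimality with the generator \<open>M\<close> of
  the annihilator, so \<open>coprime_right_ore\<close> supplies the multiplier.\<close>

lemma inj_L_ore:
  assumes s: "s \<in> R" "inj (L s)" and r: "r \<in> R"
  shows "\<exists>s'\<in>R. inj (L s') \<and> rdvd s (s' * r)"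
proof -
  obtain M where "wedderburn M" and ker: "kernel M = UNIV"
    using inj_L_surj(1)[OF s] by blast
  then have M: "M \<in> R" "M \<noteq> 0" "\<And>f. f \<in> R \<Longrightarrow> (\<And>x. L f x = 0) \<Longrightarrow> rdvd M f"
    unfolding wedderburn_def by auto
  have M0: "L M x = 0" for x
    using ker unfolding kernel_def by blast
  have s0: "s \<noteq> 0"
  proof
    assume "s = 0"
    then have "(1::'a) = 0"
      using s inj_L_iff L_zero by blast
    then show False by simp
  qed
  \<comment> \<open>The divisor \<open>d\<close> is a right factor of the injective
    \<open>s\<close>, hence acts surjectively. So in M = M' d the factor \<open>M'\<close>
    annihilates everything, \<open>M\<close> divides \<open>M'\<close>, and no degree is left for
    \<open>d\<close>.\<close>
  have "coprime_right M s"
  proof -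
    obtain d \<alpha> \<beta> where d: "d \<in> R" "\<alpha> \<in> R" "\<beta> \<in> R" "d \<noteq> 0" "d = \<alpha> * M + \<beta> * s"
      "rdvd d M" "rdvd d s"
      using gcrd_lclm[OF M(1) s(1) s0] by metis
    have "surj (L d)"
      using inj_L_surj(2) inj_L_rdvd d s by blast
    obtain M' where M': "M' \<in> R" "M = M' * d"
      using d(6) by (rule rdvdE)
    have "L M' x = 0" for x
    proof -
      obtain y where "x = L d y"
        using \<open>surj (L d)\<close> by blast
      then show ?thesis
        using M0[of y] M' d(1) by (simp add: L_mult)
    qed
    then have "rdvd M M'"
      using M(3) M'(1) by blast
    have "M' \<noteq> 0"
      using M(2) M'(2) by auto
    then have "deg M \<le> deg M'"
      using M(1) rdvd_deg_le \<open>rdvd M M'\<close> by blast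
    then have "deg d = 0"
      using M'(1) d(1,4) \<open>M' \<noteq> 0\<close> deg_mult[of M' d] unfolding M'(2) by simp
    then show ?thesis
      using coprime_right_if_deg_zero[OF d(1,4) _ d(5,2,3)] by blast
  qed
  \<comment> \<open>The annihilator is stable under right multiplication too, so R M is
    two-sided.\<close>
  moreover have "rdvd M (M * f)" if "f \<in> R" for f
    using that M(1) M0 by (intro M(3)) (simp_all add: L_mult mult_closed)
  ultimately obtain s' where s': "s' \<in> R" "coprime_right M s'" "rdvd s (s' * r)"
    using coprime_right_ore[OF M(1,2) _ s(1) s0 _ r] by blast
  obtain \<alpha> \<beta> where ab: "\<alpha> \<in> R" "\<beta> \<in> R" "1 = \<alpha> * M + \<beta> * s'"
    using s'(2) unfolding coprime_right_def by blast
  have "x = 0" if "L s' x = 0" for x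
  proof -
    have "x = L (\<alpha> * M + \<beta> * s') x"
      using ab(3) L_one by metis
    also have "\<dots> = L \<alpha> (L M x) + L \<beta> (L s' x)"
      using ab(1,2) M(1) s'(1) by (simp only: L_add L_mult mult_closed)
    also have "\<dots> = 0"
      using that M0 L_zero_right ab by simp
    finally show ?thesis .
  qed
  then show ?thesis
    using inj_L_iff s' by blast
qed

end

end


section \<open>Skew polynomials and their action\<close>

lemma skew_polys_iff: "p \<in> skew_polys \<longleftrightarrow> (\<exists>n. \<forall>j>n. p j = 0)"
proof
  assume "p \<in> skew_polys"
  then have "finite {n. p n \<noteq> 0}"
    unfolding skew_polys_def by simp
  then obtain n where "\<forall>j\<in>{n. p n \<noteq> 0}. j \<le> n"
    using finite_nat_set_iff_bounded_le by blast
  then show "\<exists>n. \<forall>j>n. p j = 0"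
    by (meson mem_Collect_eq not_le)
next
  assume "\<exists>n. \<forall>j>n. p j = 0"
  then obtain n where n: "\<And>j. n < j \<Longrightarrow> p j = 0"
    by blast
  have "{j. p j \<noteq> 0} \<subseteq> {..n}"
    using n by (auto simp: not_less[symmetric])
  then show "p \<in> skew_polys"
    unfolding skew_polys_def using finite_subset by blast
qed

lemma spdeg_eqI:
  assumes "p n \<noteq> 0" "\<And>j. n < j \<Longrightarrow> p j = 0"
  shows "spdeg p = n"
proof -
  have sub: "{j. p j \<noteq> 0} \<subseteq> {..n}"
    using assms(2) by (auto simp: not_less[symmetric])
  then have "Max {j. p j \<noteq> 0} = n"
    using assms finite_subset by (intro Max_eqI) auto
  then show ?thesis
    using assms(1) unfolding spdeg_def by auto
qed

lemma spdeg_lead: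
  assumes "p \<in> skew_polys" "p \<noteq> spzero"
  shows "p (spdeg p) \<noteq> 0" "\<And>j. spdeg p < j \<Longrightarrow> p j = 0"
proof -
  have fin: "finite {j. p j \<noteq> 0}"
    using assms(1) unfolding skew_polys_def by simp
  have ne: "{j. p j \<noteq> 0} \<noteq> {}"
    using assms(2) unfolding spzero_def by auto
  have eq: "spdeg p = Max {j. p j \<noteq> 0}"
    using ne unfolding spdeg_def by auto
  show "p (spdeg p) \<noteq> 0"
    using Max_in[OF fin ne] unfolding eq by simp
  show "p j = 0" if "spdeg p < j" for j
    using Max_ge[OF fin, of j] that unfolding eq by (metis mem_Collect_eq not_le)
qed

lemma spconst_closed: "spconst c \<in> skew_polys"
  unfolding skew_polys_iff spconst_def by auto

lemma spone_closed: "spone \<in> skew_polys"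
  unfolding spone_def by (rule spconst_closed)

lemma spzero_closed: "spzero \<in> skew_polys"
  unfolding skew_polys_iff spzero_def by auto

lemma spT_closed: "spT \<in> skew_polys"
  unfolding skew_polys_iff spT_def by auto

lemma spadd_closed:
  assumes "p \<in> skew_polys" "q \<in> skew_polys"
  shows "spadd p q \<in> skew_polys"
proof -
  obtain m n where "\<forall>j>m. p j = 0" "\<forall>j>n. q j = 0"
    using assms unfolding skew_polys_iff by blast
  then show ?thesis
    unfolding skew_polys_iff spadd_def by (intro exI[of _ "max m n"]) simp
qed

lemma spsub_closed:
  assumes "p \<in> skew_polys" "q \<in> skew_polys"
  shows "spsub p q \<in> skew_polys"
proof -
  obtain m n where "\<forall>j>m. p j = 0" "\<forall>j>n. q j = 0"
    using assms unfolding skew_polys_iff by blast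
  then show ?thesis
    unfolding skew_polys_iff spsub_def by (intro exI[of _ "max m n"]) simp
qed

section \<open>Degrees and leading coefficients of products\<close>

locale skew_derivation =
  fixes \<sigma> \<delta> :: "'a::division_ring \<Rightarrow> 'a"
  assumes endo: "ring_endo \<sigma>" and derivation: "sigma_derivation \<sigma> \<delta>"
begin

lemma sigma_simps: "\<sigma> 1 = 1" "\<sigma> (x + y) = \<sigma> x + \<sigma> y" "\<sigma> (x * y) = \<sigma> x * \<sigma> y"
  using endo unfolding ring_endo_def by auto

lemma delta_simps: "\<delta> (x + y) = \<delta> x + \<delta> y" "\<delta> (x * y) = \<sigma> x * \<delta> y + \<delta> x * y"
  using derivation unfolding sigma_derivation_def by auto

lemma sigma_zero: "\<sigma> 0 = 0"
  using sigma_simps(2)[of 0 0] by simp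

lemma delta_zero: "\<delta> 0 = 0"
  using delta_simps(1)[of 0 0] by simp

lemma sigma_nonzero: "x \<noteq> 0 \<Longrightarrow> \<sigma> x \<noteq> 0"
  using sigma_simps(3)[of x "inverse x"] by (auto simp: sigma_simps)

lemma sigma_pow_nonzero: "x \<noteq> 0 \<Longrightarrow> (\<sigma> ^^ i) x \<noteq> 0"
  by (induction i) (auto simp: sigma_nonzero)

text \<open>Each multiplication by T applies \<sigma> to the leading coefficient; the \<delta> part
  never raises the degree.\<close>

lemma Tmul_pow_top:
  assumes "\<And>j. n < j \<Longrightarrow> q j = 0"
  shows "(\<forall>j>n + i. (Tmul \<sigma> \<delta> ^^ i) q j = 0) \<and> (Tmul \<sigma> \<delta> ^^ i) q (n + i) = (\<sigma> ^^ i) (q n)"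
proof (induction i)
  case 0
  then show ?case using assms by simp
next
  case (Suc i)
  then show ?case
    by (auto simp: Tmul_def sigma_zero delta_zero)
qed

lemma spmult_bounded:
  assumes "\<And>j. m < j \<Longrightarrow> p j = 0"
  shows "spmult \<sigma> \<delta> p q n = (\<Sum>i\<le>m. p i * (Tmul \<sigma> \<delta> ^^ i) q n)"
  unfolding spmult_def
  using assms by (intro sum.mono_neutral_left) (auto simp: not_less[symmetric])

text \<open>Only the term with \<open>i = m\<close> reaches index m + n. As \<sigma> is injective,
  degrees of nonzero polynomials add up.\<close>

lemma spmult_top:
  assumes p: "\<And>j. m < j \<Longrightarrow> p j = 0" and q: "\<And>j. n < j \<Longrightarrow> q j = 0"
  shows "m + n < j \<Longrightarrow> spmult \<sigma> \<delta> p q j = 0"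
    and "spmult \<sigma> \<delta> p q (m + n) = p m * (\<sigma> ^^ m) (q n)"
proof -
  have z: "(Tmul \<sigma> \<delta> ^^ i) q j = 0" if "n + i < j" for i j
    using Tmul_pow_top[where q = q and n = n, OF q] that by blast
  have eq: "spmult \<sigma> \<delta> p q j = (\<Sum>i\<le>m. p i * (Tmul \<sigma> \<delta> ^^ i) q j)" for j
    by (rule spmult_bounded) (rule p)
  show "spmult \<sigma> \<delta> p q j = 0" if "m + n < j"
    unfolding eq using that by (intro sum.neutral) (auto intro!: z)
  have "spmult \<sigma> \<delta> p q (m + n) = (\<Sum>i\<in>{m}. p i * (Tmul \<sigma> \<delta> ^^ i) q (m + n))"
    unfolding eq by (intro sum.mono_neutral_right) (auto intro!: z)
  also have "\<dots> = p m * (\<sigma> ^^ m) (q n)"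
    using Tmul_pow_top[where q = q and n = n and i = m, OF q] by (simp add: add.commute)
  finally show "spmult \<sigma> \<delta> p q (m + n) = p m * (\<sigma> ^^ m) (q n)" .
qed

lemma spmult_closed:
  assumes "p \<in> skew_polys" "q \<in> skew_polys"
  shows "spmult \<sigma> \<delta> p q \<in> skew_polys"
proof -
  obtain m n where "\<And>j. j > m \<Longrightarrow> p j = 0" "\<And>j. j > n \<Longrightarrow> q j = 0"
    using assms unfolding skew_polys_iff by blast
  then show ?thesis
    unfolding skew_polys_iff using spmult_top(1) by blast
qed

lemma spdeg_spmult:
  assumes "p \<in> skew_polys" "q \<in> skew_polys" "p \<noteq> spzero" "q \<noteq> spzero"
  shows "spdeg (spmult \<sigma> \<delta> p q) = spdeg p + spdeg q"
  using spmult_top[of "spdeg p" p "spdeg q" q] spdeg_lead assms sigma_pow_nonzero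
  by (intro spdeg_eqI) auto

lemma spmult_spconst: "spmult \<sigma> \<delta> (spconst c) q = (\<lambda>n. c * q n)"
proof
  fix n
  have "spmult \<sigma> \<delta> (spconst c) q n = (\<Sum>i\<le>0. spconst c i * (Tmul \<sigma> \<delta> ^^ i) q n)"
    by (rule spmult_bounded) (simp add: spconst_def)
  then show "spmult \<sigma> \<delta> (spconst c) q n = c * q n"
    by (simp add: spconst_def)
qed

section \<open>The module K = R / R (T - a)\<close>

text \<open>This is left multiplication by T on residues, since T x = \<sigma>(x) T + \<delta>(x)
  and T is congruent to \<open>a\<close>.\<close>

definition Tact :: "'a \<Rightarrow> 'a \<Rightarrow> 'a" where
  "Tact a x = \<sigma> x * a + \<delta> x"

definition spact :: "'a \<Rightarrow> (nat \<Rightarrow> 'a) \<Rightarrow> 'a \<Rightarrow> 'a" where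
  "spact a p x = (\<Sum>i\<in>{i. p i \<noteq> 0}. p i * (Tact a ^^ i) x)"

text \<open>For nonzero \<open>c\<close> the condition says that \<open>c\<close> fixes
  \<open>a\<close> under \<open>sd_act\<close>, so this is the stabilizer of \<open>a\<close>
  together with 0. Right multiplication by its elements commutes with the action.\<close>

definition centralizer :: "'a \<Rightarrow> 'a set" where
  "centralizer a = {c. Tact a c = a * c}"

lemma Tact_add: "Tact a (x + y) = Tact a x + Tact a y"
  unfolding Tact_def by (simp add: sigma_simps delta_simps distrib_right)

lemma Tact_zero: "Tact a 0 = 0"
  unfolding Tact_def by (simp add: sigma_zero delta_zero)

lemma Tact_mult: "Tact a (x * y) = \<sigma> x * Tact a y + \<delta> x * y"
  unfolding Tact_def by (simp add: sigma_simps delta_simps distrib_left mult.assoc)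

lemma Tact_sum: "Tact a (\<Sum>i\<in>A. f i) = (\<Sum>i\<in>A. Tact a (f i))"
  by (induction A rule: infinite_finite_induct) (auto simp: Tact_add Tact_zero)

lemma Tact_centralizer: "c \<in> centralizer a \<Longrightarrow> Tact a (x * c) = Tact a x * c"
  unfolding centralizer_def by (simp add: Tact_mult) (simp add: Tact_def distrib_right mult.assoc)

lemma Tact_pow_add: "(Tact a ^^ i) (x + y) = (Tact a ^^ i) x + (Tact a ^^ i) y"
  by (induction i) (auto simp: Tact_add)

lemma Tact_pow_centralizer: "c \<in> centralizer a \<Longrightarrow> (Tact a ^^ i) (x * c) = (Tact a ^^ i) x * c"
  by (induction i) (auto simp: Tact_centralizer)

lemma sd_act_eq: "sd_act \<sigma> \<delta> x a = Tact a x * inverse x"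
  unfolding sd_act_def Tact_def by (simp add: distrib_right)

lemma sd_act_sd_act:
  assumes "x \<noteq> 0" "b \<noteq> 0"
  shows "sd_act \<sigma> \<delta> b (sd_act \<sigma> \<delta> x a) = sd_act \<sigma> \<delta> (b * x) a"
proof -
  have "sd_act \<sigma> \<delta> (b * x) a = (\<sigma> b * Tact a x + \<delta> b * x) * (inverse x * inverse b)"
    unfolding sd_act_eq Tact_mult using assms by (simp add: nonzero_inverse_mult_distrib)
  also have "\<dots> = \<sigma> b * (Tact a x * inverse x) * inverse b + \<delta> b * (x * inverse x) * inverse b"
    by (simp only: distrib_right mult.assoc)
  finally show ?thesis
    using assms by (simp add: sd_act_def[of _ _ b] sd_act_eq[of x])
qed

text \<open>It bounds the kernel of T - b on K, for b the conjugate of \<open>a\<close> by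
  \<open>u\<close>, by a single line over the centralizer: put y = u c, expand by the product rule
  and cancel \<open>\<sigma> u\<close>.\<close>

lemma centralizer_if_Tact_eq:
  assumes "u \<noteq> 0" "Tact a y = sd_act \<sigma> \<delta> u a * y"
  shows "inverse u * y \<in> centralizer a"
proof -
  define c where "c = inverse u * y"
  have y: "y = u * c"
    unfolding c_def using assms(1) by (simp add: mult.assoc[symmetric])
  have "\<sigma> u * Tact a c + \<delta> u * c = Tact a u * c"
    using assms unfolding y Tact_mult sd_act_eq by (simp add: mult.assoc) (simp add: mult.assoc[symmetric])
  then have "\<sigma> u * Tact a c = \<sigma> u * (a * c)"
    unfolding Tact_def[of a u] by (simp add: distrib_right mult.assoc)
  then show ?thesis
    using sigma_nonzero[OF assms(1)] unfolding centralizer_def c_def[symmetric] by simp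
qed

lemma spact_bounded:
  assumes "\<And>j. m < j \<Longrightarrow> p j = 0"
  shows "spact a p x = (\<Sum>i\<le>m. p i * (Tact a ^^ i) x)"
  unfolding spact_def
  using assms by (intro sum.mono_neutral_left) (auto simp: not_less[symmetric])

lemma spact_add_right: "spact a p (x + y) = spact a p x + spact a p y"
  unfolding spact_def by (simp add: Tact_pow_add distrib_left sum.distrib)

lemma spact_centralizer: "c \<in> centralizer a \<Longrightarrow> spact a p (x * c) = spact a p x * c"
  unfolding spact_def by (simp add: Tact_pow_centralizer sum_distrib_right mult.assoc)

lemma spact_add:
  assumes "p \<in> skew_polys" "q \<in> skew_polys"
  shows "spact a (spadd p q) x = spact a p x + spact a q x"
proof -
  obtain m n where "\<And>j. j > m \<Longrightarrow> p j = 0" "\<And>j. j > n \<Longrightarrow> q j = 0"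
    using assms unfolding skew_polys_iff by blast
  then show ?thesis
    using spact_bounded[of "max m n" p a x] spact_bounded[of "max m n" q a x]
      spact_bounded[of "max m n" "spadd p q" a x]
    by (simp add: spadd_def distrib_right sum.distrib)
qed

lemma spact_spconst: "spact a (spconst c) x = c * x"
  using spact_bounded[of 0 "spconst c"] by (simp add: spconst_def)

lemma spact_spT: "spact a spT x = Tact a x"
  using spact_bounded[of 1 spT] by (simp add: spT_def)

text \<open>\<open>Tact\<close> obeys the product rule that defines \<open>Tmul\<close>; shifting
  the index in the \<sigma> part matches the two sums.\<close>

lemma spact_Tmul:
  assumes "q \<in> skew_polys"
  shows "spact a (Tmul \<sigma> \<delta> q) x = Tact a (spact a q x)"
proof -
  obtain n where n: "\<And>j. j > n \<Longrightarrow> q j = 0"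
    using assms unfolding skew_polys_iff by blast
  let ?y = "\<lambda>i. (Tact a ^^ i) x"
  have "spact a (Tmul \<sigma> \<delta> q) x = (\<Sum>i\<le>Suc n. Tmul \<sigma> \<delta> q i * ?y i)"
    using n by (intro spact_bounded) (simp add: Tmul_def sigma_zero delta_zero)
  also have "\<dots> = (\<Sum>i\<le>Suc n. (if i = 0 then 0 else \<sigma> (q (i - 1))) * ?y i) + (\<Sum>i\<le>Suc n. \<delta> (q i) * ?y i)"
    unfolding Tmul_def by (simp only: distrib_right sum.distrib)
  also have "(\<Sum>i\<le>Suc n. (if i = 0 then 0 else \<sigma> (q (i - 1))) * ?y i) = (\<Sum>i\<le>n. \<sigma> (q i) * ?y (Suc i))"
    by (subst sum.atMost_Suc_shift) simp
  also have "(\<Sum>i\<le>Suc n. \<delta> (q i) * ?y i) = (\<Sum>i\<le>n. \<delta> (q i) * ?y i)"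
    using n by (simp add: delta_zero)
  also have "(\<Sum>i\<le>n. \<sigma> (q i) * ?y (Suc i)) + (\<Sum>i\<le>n. \<delta> (q i) * ?y i) = Tact a (\<Sum>i\<le>n. q i * ?y i)"
    by (simp add: Tact_sum Tact_mult sum.distrib)
  also have "\<dots> = Tact a (spact a q x)"
    by (subst spact_bounded[where p = q and m = n, OF n]) auto
  finally show ?thesis .
qed

lemma Tmul_pow_closed: "q \<in> skew_polys \<Longrightarrow> (Tmul \<sigma> \<delta> ^^ i) q \<in> skew_polys"
  unfolding skew_polys_iff using Tmul_pow_top by blast

lemma spact_Tmul_pow: "q \<in> skew_polys \<Longrightarrow> spact a ((Tmul \<sigma> \<delta> ^^ i) q) x = (Tact a ^^ i) (spact a q x)"
  by (induction i) (auto simp: spact_Tmul Tmul_pow_closed)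

lemma spact_spmult:
  assumes "p \<in> skew_polys" "q \<in> skew_polys"
  shows "spact a (spmult \<sigma> \<delta> p q) x = spact a p (spact a q x)"
proof -
  obtain m n where m: "\<And>j. j > m \<Longrightarrow> p j = 0" and n: "\<And>j. j > n \<Longrightarrow> q j = 0"
    using assms unfolding skew_polys_iff by blast
  let ?y = "\<lambda>i. (Tact a ^^ i) x"
  \<comment> \<open>The bound m + n serves all powers with \<open>i \<le> m\<close> at once, so the
    two sums can be interchanged below.\<close>
  have *: "(\<Sum>j\<le>m + n. (Tmul \<sigma> \<delta> ^^ i) q j * ?y j) = (Tact a ^^ i) (spact a q x)" if "i \<le> m" for i
  proof -
    have "spact a ((Tmul \<sigma> \<delta> ^^ i) q) x = (\<Sum>j\<le>m + n. (Tmul \<sigma> \<delta> ^^ i) q j * ?y j)"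
      using Tmul_pow_top[where q = q and n = n, OF n] that by (intro spact_bounded) auto
    then show ?thesis
      using spact_Tmul_pow[OF assms(2)] by simp
  qed
  have "spact a (spmult \<sigma> \<delta> p q) x = (\<Sum>j\<le>m + n. spmult \<sigma> \<delta> p q j * ?y j)"
    using spmult_top(1)[where p = p and q = q, OF m n] by (intro spact_bounded)
  also have "\<dots> = (\<Sum>j\<le>m + n. \<Sum>i\<le>m. p i * ((Tmul \<sigma> \<delta> ^^ i) q j * ?y j))"
    by (simp only: spmult_bounded[where p = p and m = m, OF m] sum_distrib_right mult.assoc)
  also have "\<dots> = (\<Sum>i\<le>m. \<Sum>j\<le>m + n. p i * ((Tmul \<sigma> \<delta> ^^ i) q j * ?y j))"
    by (rule sum.swap)
  also have "\<dots> = (\<Sum>i\<le>m. p i * (Tact a ^^ i) (spact a q x))"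
    by (intro sum.cong refl) (simp add: sum_distrib_left[symmetric] *)
  also have "\<dots> = spact a p (spact a q x)"
    by (subst spact_bounded[where p = p and m = m, OF m]) auto
  finally show ?thesis .
qed

lemma spact_spsub:
  assumes "p \<in> skew_polys" "q \<in> skew_polys"
  shows "spact a (spsub p q) x = spact a p x - spact a q x"
proof -
  have "spadd (spsub p q) q = p"
    unfolding spadd_def spsub_def by simp
  then show ?thesis
    using spact_add[of "spsub p q" q] assms spsub_closed by (metis add_diff_cancel_right')
qed

end

section \<open>Skew rational functions\<close>

locale skew_fraction = skew_derivation \<sigma> \<delta>
  for \<sigma> \<delta> :: "'a::division_ring \<Rightarrow> 'a" +
  fixes \<iota> :: "(nat \<Rightarrow> 'a) \<Rightarrow> 'd::division_ring" and a :: 'a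
  assumes frac: "left_frac_ring \<sigma> \<delta> \<iota>"
begin

definition polys :: "'d set" where
  "polys = \<iota> ` skew_polys"

definition coeffs :: "'d \<Rightarrow> nat \<Rightarrow> 'a" where
  "coeffs = the_inv_into skew_polys \<iota>"

definition degree :: "'d \<Rightarrow> nat" where
  "degree f = spdeg (coeffs f)"

definition act :: "'d \<Rightarrow> 'a \<Rightarrow> 'a" where
  "act f x = spact a (coeffs f) x"

lemma iota_inj: "inj_on \<iota> skew_polys"
  using frac unfolding left_frac_ring_def by simp

lemma iota_eq_iff: "p \<in> skew_polys \<Longrightarrow> q \<in> skew_polys \<Longrightarrow> \<iota> p = \<iota> q \<longleftrightarrow> p = q"
  using iota_inj by (simp add: inj_on_eq_iff)

lemma iota_one: "\<iota> spone = 1"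
  using frac unfolding left_frac_ring_def by simp

lemma iota_add: "p \<in> skew_polys \<Longrightarrow> q \<in> skew_polys \<Longrightarrow> \<iota> (spadd p q) = \<iota> p + \<iota> q"
  using frac unfolding left_frac_ring_def by simp

lemma iota_mult: "p \<in> skew_polys \<Longrightarrow> q \<in> skew_polys \<Longrightarrow> \<iota> (spmult \<sigma> \<delta> p q) = \<iota> p * \<iota> q"
  using frac unfolding left_frac_ring_def by simp

lemma iota_zero: "\<iota> spzero = 0"
  using iota_add[OF spzero_closed spzero_closed] by (simp add: spadd_def spzero_def)

lemma iota_eq_zero_iff: "p \<in> skew_polys \<Longrightarrow> \<iota> p = 0 \<longleftrightarrow> p = spzero"
  using iota_eq_iff[OF _ spzero_closed] iota_zero by simp

lemma iota_diff:
  assumes "p \<in> skew_polys" "q \<in> skew_polys"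
  shows "\<iota> (spsub p q) = \<iota> p - \<iota> q"
proof -
  have "spadd (spsub p q) q = p"
    unfolding spadd_def spsub_def by simp
  then show ?thesis
    using iota_add[of "spsub p q" q] assms spsub_closed by (metis add_diff_cancel_right')
qed

lemma fraction_exists: "\<exists>p\<in>skew_polys. \<exists>q\<in>skew_polys. p \<noteq> spzero \<and> f = inverse (\<iota> p) * \<iota> q"
  using frac unfolding left_frac_ring_def by simp

lemma coeffs_iota: "p \<in> skew_polys \<Longrightarrow> coeffs (\<iota> p) = p"
  unfolding coeffs_def by (rule the_inv_into_f_f[OF iota_inj])

lemma polysE:
  assumes "f \<in> polys"
  obtains p where "p \<in> skew_polys" "f = \<iota> p"
  using assms unfolding polys_def by blast

lemma iota_polys: "p \<in> skew_polys \<Longrightarrow> \<iota> p \<in> polys"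
  unfolding polys_def by blast

lemma degree_iota: "p \<in> skew_polys \<Longrightarrow> degree (\<iota> p) = spdeg p"
  unfolding degree_def by (simp add: coeffs_iota)

lemma act_iota: "p \<in> skew_polys \<Longrightarrow> act (\<iota> p) = spact a p"
  unfolding act_def by (auto simp: coeffs_iota)

text \<open>Induction on a strict bound \<open>n\<close> for the indices of the dividend. The
  equation is stated under \<iota>, where the ring laws are available.\<close>

lemma spdivision:
  assumes s: "s \<in> skew_polys" "s \<noteq> spzero"
  shows "r \<in> skew_polys \<Longrightarrow> (\<And>j. n \<le> j \<Longrightarrow> r j = 0) \<Longrightarrow>
    \<exists>q\<in>skew_polys. \<exists>t\<in>skew_polys. \<iota> r = \<iota> q * \<iota> s + \<iota> t \<and> (\<forall>j\<ge>spdeg s. t j = 0)"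
proof (induction n arbitrary: r)
  case 0
  then have "r = spzero"
    unfolding spzero_def by auto
  then have "\<iota> r = \<iota> spzero * \<iota> s + \<iota> spzero" "\<forall>j\<ge>spdeg s. spzero j = (0::'a)"
    using iota_zero unfolding spzero_def by auto
  then show ?case
    using spzero_closed by blast
next
  case (Suc n)
  show ?case
  proof (cases "Suc n \<le> spdeg s")
    case True
    then have "\<iota> r = \<iota> spzero * \<iota> s + \<iota> r" "\<forall>j\<ge>spdeg s. r j = 0"
      using iota_zero Suc.prems(2) by auto
    then show ?thesis
      using spzero_closed Suc.prems(1) by blast
  next
    case False
    define k where "k = n - spdeg s"
    have n: "n = k + spdeg s"
      using False unfolding k_def by simp
    \<comment> \<open>T^k s has leading coefficient \<open>(\<sigma> ^^ k) (s (spdeg s))\<close>. As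
      \<open>c\<close> stands to its left, inverting it suffices to cancel
      \<open>r n\<close>.\<close>
    define c where "c = r n * inverse ((\<sigma> ^^ k) (s (spdeg s)))"
    define m where "m = (\<lambda>i. if i = k then c else 0)"
    have m0: "m j = 0" if "k < j" for j
      using that unfolding m_def by simp
    then have m: "m \<in> skew_polys"
      unfolding skew_polys_iff by blast
    have ms: "spmult \<sigma> \<delta> m s \<in> skew_polys"
      using spmult_closed m s by blast
    have top: "spmult \<sigma> \<delta> m s n = r n"
      using spmult_top(2)[of k m "spdeg s" s] m0 spdeg_lead[OF s] sigma_pow_nonzero
      unfolding n[symmetric] m_def c_def by (simp add: mult.assoc)
    have above: "spmult \<sigma> \<delta> m s j = 0" if "n < j" for j
      using spmult_top(1)[of k m "spdeg s" s] m0 spdeg_lead[OF s] that n by simp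
    have "spsub r (spmult \<sigma> \<delta> m s) j = 0" if "n \<le> j" for j
      using that top above[of j] Suc.prems(2)[of j] unfolding spsub_def by (cases "j = n") auto
    then obtain q t where qt: "q \<in> skew_polys" "t \<in> skew_polys"
      "\<iota> (spsub r (spmult \<sigma> \<delta> m s)) = \<iota> q * \<iota> s + \<iota> t" "\<forall>j\<ge>spdeg s. t j = 0"
      using Suc.IH[OF spsub_closed[OF Suc.prems(1) ms]] by blast
    have "\<iota> r = \<iota> (spadd q m) * \<iota> s + \<iota> t"
      using qt Suc.prems(1) ms m s by (simp add: iota_diff iota_mult iota_add algebra_simps)
    then show ?thesis
      using qt spadd_closed m by blast
  qed
qed

sublocale left_euclidean_subring polys degree
proof
  show "1 \<in> polys"
    using iota_polys[OF spone_closed] iota_one by simp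
  show "x - y \<in> polys" if "x \<in> polys" "y \<in> polys" for x y
    using that by (elim polysE) (metis iota_diff spsub_closed iota_polys)
  show "x * y \<in> polys" if "x \<in> polys" "y \<in> polys" for x y
    using that by (elim polysE) (metis iota_mult spmult_closed iota_polys)
  show "degree (x * y) = degree x + degree y"
    if xy: "x \<in> polys" "y \<in> polys" "x \<noteq> 0" "y \<noteq> 0" for x y
  proof -
    obtain p q where "p \<in> skew_polys" "x = \<iota> p" "q \<in> skew_polys" "y = \<iota> q"
      using xy(1,2) by (meson polysE)
    then show ?thesis
      using that degree_iota spmult_closed iota_eq_zero_iff spdeg_spmult
      by (simp add: iota_mult[symmetric])
  qed
  show "\<exists>q\<in>polys. \<exists>t\<in>polys. r = q * s + t \<and> (t = 0 \<or> degree t < degree s)"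
    if rs: "r \<in> polys" "s \<in> polys" "s \<noteq> 0" for r s
  proof -
    obtain p q where pq: "p \<in> skew_polys" "r = \<iota> p" "q \<in> skew_polys" "s = \<iota> q"
      using rs(1,2) by (meson polysE)
    obtain n where "\<And>j. n < j \<Longrightarrow> p j = 0"
      using pq(1) unfolding skew_polys_iff by blast
    then have n: "\<And>j. Suc n \<le> j \<Longrightarrow> p j = 0"
      by simp
    have q0: "q \<noteq> spzero"
      using that pq iota_zero by auto
    obtain h t where ht: "h \<in> skew_polys" "t \<in> skew_polys" "\<iota> p = \<iota> h * \<iota> q + \<iota> t"
      "\<And>j. spdeg q \<le> j \<Longrightarrow> t j = 0"
      using spdivision[OF pq(3) q0 pq(1) n] by blast
    have "\<iota> t = 0 \<or> degree (\<iota> t) < degree s"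
    proof (cases "t = spzero")
      case False
      then have "spdeg t < spdeg q"
        using spdeg_lead(1)[OF ht(2)] ht(4) by (meson not_le)
      then show ?thesis
        using degree_iota pq ht by simp
    qed (simp add: iota_zero)
    then show ?thesis
      using ht pq iota_polys by blast
  qed
qed

lemma polys_degree_zero:
  assumes "f \<in> polys" "f = 0 \<or> degree f = 0"
  obtains c where "f = \<iota> (spconst c)"
proof -
  obtain p where p: "p \<in> skew_polys" "f = \<iota> p"
    using assms(1) by (rule polysE)
  have "p j = 0" if "0 < j" for j
  proof (cases "p = spzero")
    case False
    then show ?thesis
      using that assms(2) p iota_eq_zero_iff degree_iota spdeg_lead(2) by metis
  qed (simp add: spzero_def)
  then have "p = spconst (p 0)"
    unfolding spconst_def by auto
  then show thesis
    using that p by metis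
qed

section \<open>Linear polynomials and evaluation\<close>

definition lin :: "'a \<Rightarrow> nat \<Rightarrow> 'a" where
  "lin b = spsub spT (spconst b)"

lemma lin_closed: "lin b \<in> skew_polys"
  unfolding lin_def by (intro spsub_closed spT_closed spconst_closed)

lemma spdeg_lin: "spdeg (lin b) = 1"
  by (rule spdeg_eqI) (auto simp: lin_def spsub_def spT_def spconst_def)

lemma lin_monic: "spmonic (lin b)"
proof -
  have "lin b 1 = 1"
    unfolding lin_def spsub_def spT_def spconst_def by simp
  then show ?thesis
    unfolding spmonic_def spdeg_lin using lin_closed by (auto simp: spzero_def)
qed

lemma lin_nonzero: "lin b \<noteq> spzero"
  using lin_monic unfolding spmonic_def by blast

lemma spact_lin: "spact a (lin b) x = Tact a x - b * x"
  unfolding lin_def by (simp add: spact_spsub spT_closed spconst_closed spact_spT spact_spconst)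

lemma spact_lin_sd_act: "x \<noteq> 0 \<Longrightarrow> spact a (lin (sd_act \<sigma> \<delta> x a)) x = 0"
  unfolding spact_lin sd_act_eq by (simp add: mult.assoc)

lemma lin_remainder:
  assumes "p \<in> skew_polys"
  obtains q c where "q \<in> skew_polys" "spsub p (spconst c) = spmult \<sigma> \<delta> q (lin b)"
proof -
  have "\<iota> (lin b) \<in> polys" "\<iota> (lin b) \<noteq> 0" "degree (\<iota> (lin b)) = 1"
    using lin_closed lin_nonzero spdeg_lin iota_polys iota_eq_zero_iff degree_iota by auto
  then obtain f t where f: "f \<in> polys" "t \<in> polys" "\<iota> p = f * \<iota> (lin b) + t" "t = 0 \<or> degree t = 0"
    using division[OF iota_polys[OF assms], of "\<iota> (lin b)"] by auto
  obtain c where c: "t = \<iota> (spconst c)"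
    using polys_degree_zero f(2,4) by blast
  obtain q where q: "q \<in> skew_polys" "f = \<iota> q"
    using f(1) by (rule polysE)
  have "\<iota> (spsub p (spconst c)) = \<iota> (spmult \<sigma> \<delta> q (lin b))"
    using f(3) c q assms by (simp add: iota_diff iota_mult spconst_closed lin_closed)
  then have "spsub p (spconst c) = spmult \<sigma> \<delta> q (lin b)"
    using iota_eq_iff q assms spsub_closed spconst_closed spmult_closed lin_closed by metis
  then show thesis
    using q that by blast
qed

lemma spact_remainder:
  assumes "p \<in> skew_polys" "q \<in> skew_polys" "x \<noteq> 0"
    and "spsub p (spconst c) = spmult \<sigma> \<delta> q (lin (sd_act \<sigma> \<delta> x a))"
  shows "spact a p x = c * x"
proof -
  have "spact a p x - c * x = spact a (spsub p (spconst c)) x"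
    using assms(1) by (simp add: spact_spsub spconst_closed spact_spconst)
  also have "\<dots> = spact a q 0"
    unfolding assms(4) using assms(2,3) by (simp add: spact_spmult lin_closed spact_lin_sd_act)
  also have "\<dots> = 0"
    using spact_add_right[of a q 0 0] by simp
  finally show ?thesis by simp
qed

text \<open>Existence of the value comes from division by T - b. For uniqueness, T - b kills
  \<open>x\<close>, so the action of \<open>p\<close> on \<open>x\<close> determines the
  remainder.\<close>

lemma speval_sd_act:
  assumes p: "p \<in> skew_polys" and x: "x \<noteq> 0"
  shows "speval \<sigma> \<delta> p (sd_act \<sigma> \<delta> x a) = spact a p x * inverse x"
  unfolding speval_def lin_def[symmetric]
proof (rule the_equality)
  obtain q c where q: "q \<in> skew_polys" "spsub p (spconst c) = spmult \<sigma> \<delta> q (lin (sd_act \<sigma> \<delta> x a))"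
    using lin_remainder[OF p] by blast
  then have "c = spact a p x * inverse x"
    using spact_remainder[OF p q(1) x q(2)] x by (simp add: mult.assoc)
  then show "\<exists>q\<in>skew_polys. spsub p (spconst (spact a p x * inverse x)) =
      spmult \<sigma> \<delta> q (lin (sd_act \<sigma> \<delta> x a))"
    using q by blast
next
  fix c assume "\<exists>q\<in>skew_polys. spsub p (spconst c) = spmult \<sigma> \<delta> q (lin (sd_act \<sigma> \<delta> x a))"
  then show "c = spact a p x * inverse x"
    using spact_remainder[OF p _ x] x by (auto simp: mult.assoc)
qed

lemma rdvd_lin_iff:
  assumes p: "p \<in> skew_polys" and x: "x \<noteq> 0"
  shows "spact a p x = 0 \<longleftrightarrow> (\<exists>q\<in>skew_polys. p = spmult \<sigma> \<delta> q (lin (sd_act \<sigma> \<delta> x a)))"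
proof
  assume 0: "spact a p x = 0"
  obtain q c where q: "q \<in> skew_polys" "spsub p (spconst c) = spmult \<sigma> \<delta> q (lin (sd_act \<sigma> \<delta> x a))"
    using lin_remainder[OF p] by blast
  then have "c = 0"
    using spact_remainder[OF p q(1) x q(2)] x 0 by simp
  then have "spsub p (spconst c) = p"
    unfolding spsub_def spconst_def by auto
  then show "\<exists>q\<in>skew_polys. p = spmult \<sigma> \<delta> q (lin (sd_act \<sigma> \<delta> x a))"
    using q by metis
next
  assume "\<exists>q\<in>skew_polys. p = spmult \<sigma> \<delta> q (lin (sd_act \<sigma> \<delta> x a))"
  then obtain q where "q \<in> skew_polys" and q: "p = spmult \<sigma> \<delta> q (lin (sd_act \<sigma> \<delta> x a))"
    by blast
  moreover have "spsub p (spconst 0) = p"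
    unfolding spsub_def spconst_def by auto
  ultimately show "spact a p x = 0"
    using spact_remainder[OF p _ x, of q 0] by simp
qed

sublocale euclidean_action polys degree act "centralizer a"
proof
  show "act 1 x = x" for x
    using act_iota[OF spone_closed] iota_one spact_spconst[of a 1] unfolding spone_def by simp
  show "act (f + g) x = act f x + act g x" if "f \<in> polys" "g \<in> polys" for f g x
    using that by (elim polysE) (simp add: iota_add[symmetric] act_iota spadd_closed spact_add)
  show "act (f * g) x = act f (act g x)" if "f \<in> polys" "g \<in> polys" for f g x
    using that by (elim polysE) (simp add: iota_mult[symmetric] act_iota spmult_closed spact_spmult)
  show "act f (x + y) = act f x + act f y" for f x y
    unfolding act_def by (rule spact_add_right)
  show "act f (x * c) = act f x * c" if "c \<in> centralizer a" for f x c
    unfolding act_def using that by (rule spact_centralizer)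
  show "\<exists>t\<in>polys. degree t = 1 \<and> t \<noteq> 0 \<and> (\<forall>y. act t y = 0 \<longrightarrow> (\<exists>c\<in>centralizer a. y = u * c)) \<and>
      (\<forall>f\<in>polys. act f u = 0 \<longleftrightarrow> rdvd t f)" if u: "u \<noteq> 0" for u
  proof -
    let ?t = "lin (sd_act \<sigma> \<delta> u a)"
    have t: "\<iota> ?t \<in> polys" "degree (\<iota> ?t) = 1" "\<iota> ?t \<noteq> 0"
      using lin_closed lin_nonzero spdeg_lin iota_polys iota_eq_zero_iff degree_iota by auto
    have "\<exists>c\<in>centralizer a. y = u * c" if "act (\<iota> ?t) y = 0" for y
    proof (rule bexI)
      show "inverse u * y \<in> centralizer a"
        using that by (intro centralizer_if_Tact_eq[OF u]) (simp add: act_iota lin_closed spact_lin)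
      show "y = u * (inverse u * y)"
        using u by (simp add: mult.assoc[symmetric])
    qed
    moreover have "act f u = 0 \<longleftrightarrow> rdvd (\<iota> ?t) f" if f: "f \<in> polys" for f
    proof -
      obtain p where p: "p \<in> skew_polys" "f = \<iota> p"
        using f by (rule polysE)
      have "rdvd (\<iota> ?t) f \<longleftrightarrow> (\<exists>q\<in>skew_polys. \<iota> p = \<iota> (spmult \<sigma> \<delta> q ?t))"
        unfolding rdvd_def unfolding polys_def p by (auto simp: iota_mult lin_closed)
      also have "\<dots> \<longleftrightarrow> (\<exists>q\<in>skew_polys. p = spmult \<sigma> \<delta> q ?t)"
        using iota_eq_iff p spmult_closed lin_closed by metis
      finally show ?thesis
        using rdvd_lin_iff[OF p(1) u] p act_iota by simp
    qed
    ultimately show ?thesis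
      using t by blast
  qed
qed

section \<open>Nonvanishing and skew invertibility in terms of the action\<close>

lemma speval_nonvanishing_iff:
  assumes "p \<in> skew_polys"
  shows "(\<forall>c\<in>conj_class \<sigma> \<delta> a. speval \<sigma> \<delta> p c \<noteq> 0) \<longleftrightarrow> inj (act (\<iota> p))"
proof -
  have "(\<forall>c\<in>conj_class \<sigma> \<delta> a. speval \<sigma> \<delta> p c \<noteq> 0) \<longleftrightarrow> (\<forall>x. x \<noteq> 0 \<longrightarrow> spact a p x * inverse x \<noteq> 0)"
    unfolding conj_class_def using speval_sd_act[OF assms] by auto
  then show ?thesis
    using inj_L_iff[OF iota_polys[OF assms]] act_iota[OF assms] by auto
qed

text \<open>Under \<open>f \<mapsto> (x \<mapsto> f ({}\<^sup>x a) x)\<close> the skew product becomes composition of maps \<open>K \<rightarrow> K\<close>, and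
  evaluation of \<open>p\<close> becomes the action of \<open>p\<close>.\<close>
lemma skew_invertible_imp_inj:
  assumes p: "p \<in> skew_polys"
    and inv: "skew_invertible (conj_class \<sigma> \<delta> a) (\<lambda>z b. sd_act \<sigma> \<delta> b z) (speval \<sigma> \<delta> p)"
  shows "inj (act (\<iota> p))"
proof -
  \<comment> \<open>At a zero of \<open>p\<close> the default case of \<open>skew_prod\<close> gives
    0 rather than 1.\<close>
  have "speval \<sigma> \<delta> p c \<noteq> 0" if "c \<in> conj_class \<sigma> \<delta> a" for c
    using inv that unfolding skew_invertible_def skew_prod_def by (metis zero_neq_one)
  then show ?thesis
    using speval_nonvanishing_iff[OF p] by blast
qed

text \<open>The inverse map M commutes with the centralizer, so \<open>M x * inverse x\<close>
  depends only on the conjugate of \<open>a\<close> by \<open>x\<close>. This function on the class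
  is the skew inverse.\<close>

lemma bij_imp_skew_invertible:
  assumes p: "p \<in> skew_polys" and bij: "bij (act (\<iota> p))"
  shows "skew_invertible (conj_class \<sigma> \<delta> a) (\<lambda>z b. sd_act \<sigma> \<delta> b z) (speval \<sigma> \<delta> p)"
proof -
  let ?L = "spact a p"
  have bij: "bij ?L"
    using bij act_iota[OF p] by simp
  define M where "M = inv ?L"
  have M1: "?L (M x) = x" and M2: "M (?L x) = x" for x
    unfolding M_def using bij by (simp_all add: bij_is_surj surj_f_inv_f bij_is_inj)
  have L0: "?L x \<noteq> 0" and M0: "M x \<noteq> 0" if "x \<noteq> 0" for x
    using that M1 M2 spact_add_right[of a p 0 0] by (metis add_cancel_right_right)+
  have MC: "M (x * c) = M x * c" if "c \<in> centralizer a" for x c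
    using M1 M2 spact_centralizer[OF that] by metis
  define rep where "rep z = (SOME x. x \<noteq> 0 \<and> z = sd_act \<sigma> \<delta> x a)" for z
  define g where "g z = M (rep z) * inverse (rep z)" for z
  have g: "g (sd_act \<sigma> \<delta> x a) = M x * inverse x" if x: "x \<noteq> 0" for x
  proof -
    define y where "y = rep (sd_act \<sigma> \<delta> x a)"
    have y: "y \<noteq> 0" "sd_act \<sigma> \<delta> x a = sd_act \<sigma> \<delta> y a"
      using someI[of "\<lambda>y. y \<noteq> 0 \<and> sd_act \<sigma> \<delta> x a = sd_act \<sigma> \<delta> y a" x] x
      unfolding y_def rep_def by auto
    \<comment> \<open>Two representatives of one conjugate differ by a right factor \<open>c\<close>
      in the centralizer, which cancels.\<close>
    define c where "c = inverse x * y"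
    have yc: "y = x * c" and c0: "c \<noteq> 0"
      using x y unfolding c_def by (simp_all add: mult.assoc[symmetric])
    have "Tact a y = sd_act \<sigma> \<delta> y a * y"
      unfolding sd_act_eq using y(1) by (simp add: mult.assoc)
    then have "Tact a y = sd_act \<sigma> \<delta> x a * y"
      using y(2) by simp
    then have "c \<in> centralizer a"
      unfolding c_def using centralizer_if_Tact_eq[OF x] by blast
    then have "M y * inverse y = M x * c * (inverse c * inverse x)"
      unfolding yc using MC by (simp only: nonzero_inverse_mult_distrib[OF x c0])
    also have "\<dots> = M x * (c * inverse c) * inverse x"
      by (simp only: mult.assoc)
    finally have "M y * inverse y = M x * (c * inverse c) * inverse x" .
    then show ?thesis
      unfolding g_def y_def[symmetric] using c0 by simp
  qed
  have "skew_prod (\<lambda>z b. sd_act \<sigma> \<delta> b z) (speval \<sigma> \<delta> p) g (sd_act \<sigma> \<delta> x a) = 1 \<and>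
      skew_prod (\<lambda>z b. sd_act \<sigma> \<delta> b z) g (speval \<sigma> \<delta> p) (sd_act \<sigma> \<delta> x a) = 1" if x: "x \<noteq> 0" for x
  proof -
    have cancel: "u * inverse x * x = u" for u
      using x by (simp add: mult.assoc)
    have "sd_act \<sigma> \<delta> (M x * inverse x) (sd_act \<sigma> \<delta> x a) = sd_act \<sigma> \<delta> (M x) a"
      using sd_act_sd_act[OF x, of "M x * inverse x"] M0[OF x] x cancel by simp
    moreover have "sd_act \<sigma> \<delta> (?L x * inverse x) (sd_act \<sigma> \<delta> x a) = sd_act \<sigma> \<delta> (?L x) a"
      using sd_act_sd_act[OF x, of "?L x * inverse x"] L0[OF x] x cancel by simp
    moreover have "x * inverse (M x) * (M x * inverse x) = 1" "x * inverse (?L x) * (?L x * inverse x) = 1"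
      using x M0[OF x] L0[OF x]
      by (metis mult.assoc mult_1_right left_inverse right_inverse)+
    ultimately show ?thesis
      unfolding skew_prod_def using x M0[OF x] L0[OF x]
      by (simp add: g speval_sd_act[OF p] M1 M2)
  qed
  then show ?thesis
    unfolding skew_invertible_def conj_class_def by blast
qed

section \<open>Minimal denominators\<close>

text \<open>The u with u f in R form a nonzero left ideal, whose monic generator is the minimal
  denominator. Its uniqueness justifies the definite description in
  \<open>min_denom\<close>.\<close>

lemma min_denom_generates:
  shows "spmonic (min_denom \<iota> f)" and "\<iota> (min_denom \<iota> f) * f \<in> polys"
    and "u \<in> polys \<Longrightarrow> u * f \<in> polys \<Longrightarrow> rdvd (\<iota> (min_denom \<iota> f)) u"
proof -
  define I where "I = {u \<in> polys. u * f \<in> polys}"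
  obtain p0 q0 where pq: "p0 \<in> skew_polys" "q0 \<in> skew_polys" "p0 \<noteq> spzero" "f = inverse (\<iota> p0) * \<iota> q0"
    using fraction_exists by blast
  then have p0: "\<iota> p0 \<noteq> 0"
    using iota_eq_zero_iff by simp
  then have "\<iota> p0 * f = \<iota> q0"
    using pq by (simp add: mult.assoc[symmetric])
  then have "\<iota> p0 \<in> I"
    unfolding I_def using pq iota_polys by simp
  moreover have "x - y \<in> I" if "x \<in> I" "y \<in> I" for x y
    using that closed unfolding I_def by (simp add: left_diff_distrib)
  moreover have ideal: "r * x \<in> I" if "x \<in> I" "r \<in> polys" for x r
    using that closed unfolding I_def by (simp add: mult.assoc)
  moreover have "I \<subseteq> polys"
    unfolding I_def by blast
  ultimately obtain d where d: "d \<in> I" "d \<noteq> 0" "\<And>y. y \<in> I \<Longrightarrow> rdvd d y"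
    using left_ideal_principal[of I "\<iota> p0"] p0 by metis
  obtain D where D: "D \<in> skew_polys" "d = \<iota> D"
    using d(1) polysE unfolding I_def by blast
  have D0: "D \<noteq> spzero"
    using d D iota_zero by auto
  define l where "l = D (spdeg D)"
  have l: "l \<noteq> 0"
    unfolding l_def using spdeg_lead D D0 by blast
  \<comment> \<open>Left scaling by the inverse leading coefficient makes the generator monic and
    keeps it in the ideal.\<close>
  define P where "P = spmult \<sigma> \<delta> (spconst (inverse l)) D"
  have Pn: "P n = inverse l * D n" for n
    unfolding P_def spmult_spconst by simp
  have P: "P \<in> skew_polys"
    unfolding P_def using spmult_closed spconst_closed D by blast
  have P1: "P (spdeg D) = 1"
    unfolding Pn using l l_def by simp
  moreover have "spdeg P = spdeg D"
    using P1 spdeg_lead(2)[OF D(1) D0] by (intro spdeg_eqI) (auto simp: Pn)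
  ultimately have monic: "spmonic P"
    unfolding spmonic_def using P by (auto simp: spzero_def)
  have "\<iota> P = \<iota> (spconst (inverse l)) * d"
    unfolding P_def D(2) by (rule iota_mult[OF spconst_closed D(1)])
  then have PI: "\<iota> P \<in> I"
    using ideal[OF d(1) iota_polys[OF spconst_closed]] by simp
  have "degree (\<iota> P) = degree d"
    using degree_iota P D \<open>spdeg P = spdeg D\<close> by simp
  moreover have "\<iota> P \<noteq> 0"
    using monic P iota_eq_zero_iff unfolding spmonic_def by blast
  ultimately have "rdvd (\<iota> P) d"
    using rdvd_deg_eq_sym d PI unfolding I_def by blast
  then have gen: "rdvd (\<iota> P) u" if "u \<in> polys" "u * f \<in> polys" for u
    using that d(3) rdvd_trans unfolding I_def by blast
  have frac_iff: "(\<exists>Q\<in>skew_polys. f = inverse (\<iota> P') * \<iota> Q) \<longleftrightarrow> \<iota> P' * f \<in> polys" if "spmonic P'" for P'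
  proof -
    have "\<iota> P' \<noteq> 0"
      using that iota_eq_zero_iff unfolding spmonic_def by blast
    then have "f = inverse (\<iota> P') * g \<longleftrightarrow> \<iota> P' * f = g" for g
      by (metis left_inverse mult.assoc mult_1_left right_inverse)
    then show ?thesis
      unfolding polys_def by blast
  qed
  have le: "spdeg P \<le> spdeg P'" if "spmonic P'" "\<iota> P' * f \<in> polys" for P'
  proof -
    have "P' \<in> skew_polys" "\<iota> P' \<noteq> 0"
      using that(1) iota_eq_zero_iff unfolding spmonic_def by auto
    then show ?thesis
      using rdvd_deg_le[OF gen] iota_polys P that(2) degree_iota by metis
  qed
  have Pf: "\<iota> P * f \<in> polys"
    using PI unfolding I_def by simp
  have "min_denom \<iota> f = P"
    unfolding min_denom_def
  proof (rule the_equality)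
    show "spmonic P \<and> (\<exists>Q\<in>skew_polys. f = inverse (\<iota> P) * \<iota> Q) \<and>
      (\<forall>P'. spmonic P' \<and> (\<exists>Q\<in>skew_polys. f = inverse (\<iota> P') * \<iota> Q) \<longrightarrow> spdeg P \<le> spdeg P')"
      using monic Pf frac_iff le by blast
  next
    fix P' assume P': "spmonic P' \<and> (\<exists>Q\<in>skew_polys. f = inverse (\<iota> P') * \<iota> Q) \<and>
      (\<forall>P''. spmonic P'' \<and> (\<exists>Q\<in>skew_polys. f = inverse (\<iota> P'') * \<iota> Q) \<longrightarrow> spdeg P' \<le> spdeg P'')"
    then have m: "spmonic P'" and f: "\<iota> P' * f \<in> polys"
      using frac_iff by blast+
    have "spdeg P' \<le> spdeg P"
      using P' monic Pf frac_iff by blast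
    then have deg: "spdeg P' = spdeg P"
      using le[OF m f] by simp
    have P'R: "P' \<in> skew_polys" "\<iota> P' \<noteq> 0"
      using m iota_eq_zero_iff unfolding spmonic_def by auto
    obtain q where q: "q \<in> polys" "\<iota> P' = q * \<iota> P"
      using gen[OF iota_polys[OF P'R(1)] f] by (rule rdvdE)
    \<comment> \<open>Equal degrees make the cofactor a constant \<open>c\<close>; comparing the two
      leading coefficients 1 gives c = 1.\<close>
    then have "q \<noteq> 0"
      using P'R(2) by auto
    then have "degree q = 0"
      using deg_mult[OF q(1) iota_polys[OF P]] \<open>\<iota> P \<noteq> 0\<close> degree_iota[OF P] degree_iota[OF P'R(1)] deg
      unfolding q(2) by simp
    then obtain c where c: "q = \<iota> (spconst c)"
      using polys_degree_zero q(1) by blast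
    have "\<iota> P' = \<iota> (spmult \<sigma> \<delta> (spconst c) P)"
      using q c iota_mult[OF spconst_closed P] by simp
    then have eq: "P' = (\<lambda>n. c * P n)"
      using iota_eq_iff P'R(1) P spmult_closed spconst_closed spmult_spconst by metis
    have "P (spdeg P) = 1" "P' (spdeg P) = 1"
      using monic m deg unfolding spmonic_def by auto
    then have "c = 1"
      unfolding eq by simp
    then show "P' = P"
      unfolding eq by simp
  qed
  with monic Pf gen show "spmonic (min_denom \<iota> f)" "\<iota> (min_denom \<iota> f) * f \<in> polys"
    "u \<in> polys \<Longrightarrow> u * f \<in> polys \<Longrightarrow> rdvd (\<iota> (min_denom \<iota> f)) u"
    by simp_all
qed

text \<open>In any factorization the degrees sum to one, so one factor has degree zero and is a
  unit.\<close>

lemma lin_irreducible: "sp_irreducible \<sigma> \<delta> (lin b)"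
proof -
  have t: "\<iota> (lin b) \<noteq> 0" "degree (\<iota> (lin b)) = 1"
    using lin_closed lin_nonzero spdeg_lin iota_eq_zero_iff degree_iota by auto
  have unit: "sp_unit \<sigma> \<delta> A" if A: "A \<in> skew_polys" "\<iota> A \<noteq> 0" "degree (\<iota> A) = 0" for A
  proof -
    obtain V where V: "V \<in> skew_polys" "inverse (\<iota> A) = \<iota> V"
      using deg_zero_unit[OF iota_polys[OF A(1)] A(2,3)] by (rule polysE)
    have "\<iota> (spmult \<sigma> \<delta> A V) = \<iota> spone" "\<iota> (spmult \<sigma> \<delta> V A) = \<iota> spone"
      using A V iota_mult iota_one by (simp_all add: V(2)[symmetric])
    then have "spmult \<sigma> \<delta> A V = spone" "spmult \<sigma> \<delta> V A = spone"
      using iota_eq_iff A V spmult_closed spone_closed by blast+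
    then show ?thesis
      unfolding sp_unit_def using A V by blast
  qed
  have "\<not> sp_unit \<sigma> \<delta> (lin b)"
  proof
    assume "sp_unit \<sigma> \<delta> (lin b)"
    then obtain V where V: "V \<in> skew_polys" "spmult \<sigma> \<delta> (lin b) V = spone"
      unfolding sp_unit_def by blast
    then have "\<iota> (lin b) * \<iota> V = 1"
      using iota_mult[OF lin_closed V(1), of b] iota_one by simp
    moreover from this have "\<iota> V \<noteq> 0"
      by auto
    ultimately have "degree (\<iota> (lin b)) + degree (\<iota> V) = 0"
      using deg_mult[of "\<iota> (lin b)" "\<iota> V"] iota_polys lin_closed V t deg_one by simp
    then show False
      using t by simp
  qed
  moreover have "sp_unit \<sigma> \<delta> A \<or> sp_unit \<sigma> \<delta> B"
    if AB: "A \<in> skew_polys" "B \<in> skew_polys" "lin b = spmult \<sigma> \<delta> A B" for A B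
  proof -
    have eq: "\<iota> (lin b) = \<iota> A * \<iota> B"
      unfolding AB(3) using iota_mult AB by simp
    then have "\<iota> A \<noteq> 0" "\<iota> B \<noteq> 0"
      using t by auto
    moreover from this have "degree (\<iota> A) + degree (\<iota> B) = 1"
      using deg_mult[of "\<iota> A" "\<iota> B"] eq t iota_polys AB by simp
    ultimately show ?thesis
      using unit[OF AB(1)] unit[OF AB(2)] by (auto simp: add_is_1)
  qed
  ultimately show ?thesis
    unfolding sp_irreducible_def using lin_closed lin_nonzero by blast
qed

end

section \<open>The algebraic case and the maximal Ore set\<close>

locale skew_fraction_algebraic = skew_fraction \<sigma> \<delta> \<iota> a
  for \<sigma> \<delta> :: "'a::division_ring \<Rightarrow> 'a" and \<iota> :: "(nat \<Rightarrow> 'a) \<Rightarrow> 'd::division_ring" and a :: 'a +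
  assumes algebraic: "sd_algebraic \<sigma> \<delta> (conj_class \<sigma> \<delta> a)"
begin

lemma annihilator:
  obtains A where "A \<in> polys" "A \<noteq> 0" "\<And>x. act A x = 0"
proof -
  obtain p where p: "p \<in> skew_polys" "p \<noteq> spzero" "\<forall>c\<in>conj_class \<sigma> \<delta> a. speval \<sigma> \<delta> p c = 0"
    using algebraic unfolding sd_algebraic_def by blast
  have "spact a p x = 0" for x
  proof (cases "x = 0")
    case True
    then show ?thesis
      using spact_add_right[of a p 0 0] by simp
  next
    case False
    then have "speval \<sigma> \<delta> p (sd_act \<sigma> \<delta> x a) = 0"
      using p(3) unfolding conj_class_def by blast
    then show ?thesis
      using speval_sd_act[OF p(1) False] False by simp
  qed
  then show thesis
    using that[of "\<iota> p"] p iota_polys iota_eq_zero_iff act_iota by simp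
qed

text \<open>Any injectively acting denominator suffices: the minimal one is its right factor and
  inherits injectivity, which the algebraic hypothesis upgrades to bijectivity.\<close>

lemma Def_at_iff: "f \<in> Def_at \<sigma> \<delta> \<iota> a \<longleftrightarrow> (\<exists>u\<in>polys. inj (act u) \<and> u * f \<in> polys)"
proof -
  let ?P = "min_denom \<iota> f"
  have PR: "?P \<in> skew_polys"
    using min_denom_generates(1) unfolding spmonic_def by blast
  obtain A where A: "A \<in> polys" "A \<noteq> 0" "\<And>x. act A x = 0"
    using annihilator by blast
  have "f \<in> Def_at \<sigma> \<delta> \<iota> a \<longleftrightarrow>
      skew_invertible (conj_class \<sigma> \<delta> a) (\<lambda>z b. sd_act \<sigma> \<delta> b z) (speval \<sigma> \<delta> ?P)"
    unfolding Def_at_def defined_at_def by simp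
  also have "\<dots> \<longleftrightarrow> inj (act (\<iota> ?P))"
    using skew_invertible_imp_inj[OF PR] bij_imp_skew_invertible[OF PR]
      bij_L_iff_inj[OF A iota_polys[OF PR]] by blast
  also have "\<dots> \<longleftrightarrow> (\<exists>u\<in>polys. inj (act u) \<and> u * f \<in> polys)"
    using min_denom_generates(2,3) inj_L_rdvd iota_polys[OF PR] by blast
  finally show ?thesis .
qed

lemma inverse_in_Def_at_iff:
  assumes "Q \<in> skew_polys" "Q \<noteq> spzero"
  shows "inverse (\<iota> Q) \<in> Def_at \<sigma> \<delta> \<iota> a \<longleftrightarrow> inj (act (\<iota> Q))"
proof
  have Q0: "\<iota> Q \<noteq> 0"
    using assms iota_eq_zero_iff by simp
  assume "inverse (\<iota> Q) \<in> Def_at \<sigma> \<delta> \<iota> a"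
  then obtain u where u: "u \<in> polys" "inj (act u)" "u * inverse (\<iota> Q) \<in> polys"
    unfolding Def_at_iff by blast
  have "u = (u * inverse (\<iota> Q)) * \<iota> Q"
    using Q0 by (simp add: mult.assoc)
  then have "rdvd (\<iota> Q) u"
    using u(3) by (intro rdvdI)
  then show "inj (act (\<iota> Q))"
    using u(2) inj_L_rdvd iota_polys assms by blast
next
  assume "inj (act (\<iota> Q))"
  moreover have "\<iota> Q * inverse (\<iota> Q) \<in> polys"
    using assms iota_eq_zero_iff one_closed by simp
  ultimately show "inverse (\<iota> Q) \<in> Def_at \<sigma> \<delta> \<iota> a"
    unfolding Def_at_iff using assms iota_polys by blast
qed

definition S_inj :: "(nat \<Rightarrow> 'a) set" where
  "S_inj = {P \<in> skew_polys. inj (act (\<iota> P))}"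

lemma S_inj_nonzero: "P \<in> S_inj \<Longrightarrow> P \<noteq> spzero"
  unfolding S_inj_def using inj_L_iff iota_polys iota_zero L_zero
  by (metis (mono_tags, lifting) mem_Collect_eq zero_neq_one)

lemma S_inj_left_ore: "left_ore \<sigma> \<delta> S_inj"
  unfolding left_ore_def
proof (intro conjI ballI)
  show "S_inj \<subseteq> skew_polys - {spzero}"
    using S_inj_nonzero unfolding S_inj_def by blast
  show "spone \<in> S_inj"
    unfolding S_inj_def using spone_closed iota_one L_one by (simp add: inj_def)
  show "spmult \<sigma> \<delta> s t \<in> S_inj" if "s \<in> S_inj" "t \<in> S_inj" for s t
  proof -
    have st: "s \<in> skew_polys" "t \<in> skew_polys" "inj (act (\<iota> s))" "inj (act (\<iota> t))"
      using that unfolding S_inj_def by auto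
    then have "act (\<iota> s * \<iota> t) = act (\<iota> s) \<circ> act (\<iota> t)"
      using L_mult iota_polys by (simp add: fun_eq_iff)
    then have "inj (act (\<iota> (spmult \<sigma> \<delta> s t)))"
      using st by (simp add: iota_mult inj_compose)
    then show ?thesis
      unfolding S_inj_def using st spmult_closed by simp
  qed
  show "\<exists>s'\<in>S_inj. \<exists>r'\<in>skew_polys. spmult \<sigma> \<delta> s' r = spmult \<sigma> \<delta> r' s"
    if s: "s \<in> S_inj" and r: "r \<in> skew_polys" for s r
  proof -
    obtain A where A: "A \<in> polys" "A \<noteq> 0" "\<And>x. act A x = 0"
      using annihilator by blast
    have sR: "s \<in> skew_polys" "inj (act (\<iota> s))"
      using s unfolding S_inj_def by auto
    obtain u where u: "u \<in> polys" "inj (act u)" "rdvd (\<iota> s) (u * \<iota> r)"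
      using inj_L_ore[OF A iota_polys[OF sR(1)] sR(2) iota_polys[OF r]] by blast
    obtain s' where s': "s' \<in> skew_polys" "u = \<iota> s'"
      using u(1) by (rule polysE)
    obtain r' where r': "r' \<in> skew_polys" "u * \<iota> r = \<iota> r' * \<iota> s"
      using u(3) unfolding rdvd_def unfolding polys_def by blast
    have "\<iota> (spmult \<sigma> \<delta> s' r) = \<iota> (spmult \<sigma> \<delta> r' s)"
      using r' s' r sR iota_mult by simp
    then have "spmult \<sigma> \<delta> s' r = spmult \<sigma> \<delta> r' s"
      using iota_eq_iff spmult_closed r' s' r sR by blast
    moreover have "s' \<in> S_inj"
      unfolding S_inj_def using s' u by simp
    ultimately show ?thesis
      using r' by blast
  qed
qed

text \<open>In P = Q1 Q Q2 the right factor \<open>Q2\<close> acts injectively, hence surjectively.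
  So an element killed by \<open>Q\<close> is the image under \<open>Q2\<close> of one killed by
  \<open>P\<close>, which is 0.\<close>

lemma S_inj_good: "good_for \<sigma> \<delta> \<iota> a S_inj"
  unfolding good_for_def
proof (intro ballI allI impI, elim conjE bexE)
  fix P Q Q1 Q2
  assume P: "P \<in> S_inj" and Q: "spmonic Q" and Q1: "Q1 \<in> skew_polys" and Q2: "Q2 \<in> skew_polys"
    and eq: "P = spmult \<sigma> \<delta> (spmult \<sigma> \<delta> Q1 Q) Q2"
  obtain A where A: "A \<in> polys" "A \<noteq> 0" "\<And>x. act A x = 0"
    using annihilator by blast
  have QR: "Q \<in> skew_polys" "Q \<noteq> spzero"
    using Q unfolding spmonic_def by auto
  have R: "\<iota> Q \<in> polys" "\<iota> Q1 \<in> polys" "\<iota> Q2 \<in> polys"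
    using QR Q1 Q2 iota_polys by auto
  have inj: "inj (act (\<iota> Q1 * \<iota> Q * \<iota> Q2))"
    using P unfolding S_inj_def eq using Q1 Q2 QR by (simp add: iota_mult spmult_closed)
  then have "inj (act (\<iota> Q2))"
    using inj_L_rdvd[of "\<iota> Q2"] rdvdI[of "\<iota> Q1 * \<iota> Q"] R mult_closed by blast
  then have surj: "surj (act (\<iota> Q2))"
    using inj_L_surj(2)[OF A R(3)] by blast
  have "x = 0" if x: "act (\<iota> Q) x = 0" for x
  proof -
    obtain y where y: "x = act (\<iota> Q2) y"
      using surj by blast
    have "act (\<iota> Q1 * \<iota> Q * \<iota> Q2) y = 0"
      using x y R L_zero_right by (simp add: L_mult mult_closed)
    then have "y = 0"
      using inj inj_L_iff R mult_closed by blast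
    then show ?thesis
      using y L_zero_right R by simp
  qed
  then have "inj (act (\<iota> Q))"
    using inj_L_iff R by blast
  then show "inverse (\<iota> Q) \<in> Def_at \<sigma> \<delta> \<iota> a"
    using inverse_in_Def_at_iff QR by blast
qed

text \<open>A root \<open>{}\<^sup>x a\<close> of \<open>P\<close> splits off the factor \<open>T - {}\<^sup>x a\<close>, whose inverse is not defined at \<open>a\<close>.\<close>
lemma good_subset_S_inj:
  assumes ore: "left_ore \<sigma> \<delta> S" and good: "good_for \<sigma> \<delta> \<iota> a S"
  shows "S \<subseteq> S_inj"
proof
  fix P assume PS: "P \<in> S"
  then have P: "P \<in> skew_polys"
    using ore unfolding left_ore_def by blast
  have "x = 0" if 0: "spact a P x = 0" for x
  proof (rule ccontr)
    assume x: "x \<noteq> 0"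
    let ?t = "lin (sd_act \<sigma> \<delta> x a)"
    obtain q where q: "q \<in> skew_polys" "P = spmult \<sigma> \<delta> q ?t"
      using rdvd_lin_iff[OF P x] 0 by blast
    \<comment> \<open>\<open>good_for\<close> speaks of three factors, so a trivial right factor is
      inserted.\<close>
    have "\<iota> P = \<iota> (spmult \<sigma> \<delta> (spmult \<sigma> \<delta> q ?t) spone)"
      using q by (simp add: iota_mult iota_one spmult_closed lin_closed spone_closed)
    then have "P = spmult \<sigma> \<delta> (spmult \<sigma> \<delta> q ?t) spone"
      using iota_eq_iff P q lin_closed spone_closed spmult_closed by metis
    then have "inverse (\<iota> ?t) \<in> Def_at \<sigma> \<delta> \<iota> a"
      using good PS lin_monic lin_irreducible q(1) spone_closed unfolding good_for_def by blast
    then have "inj (act (\<iota> ?t))"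
      using inverse_in_Def_at_iff lin_closed lin_nonzero by blast
    then show False
      using x spact_lin_sd_act[OF x] inj_L_iff iota_polys lin_closed act_iota by metis
  qed
  then have "inj (act (\<iota> P))"
    using inj_L_iff[OF iota_polys[OF P]] unfolding act_iota[OF P] by blast
  then show "P \<in> S_inj"
    unfolding S_inj_def using P by simp
qed

text \<open>Every admissible Ore set lies in \<open>S_inj\<close>, which is admissible itself; a
  greatest one is the only maximal one.\<close>

lemma S_at_eq: "S_at \<sigma> \<delta> \<iota> a = S_inj"
  unfolding S_at_def
proof (rule the_equality)
  show "left_ore \<sigma> \<delta> S_inj \<and> good_for \<sigma> \<delta> \<iota> a S_inj \<and>
      (\<forall>S'. left_ore \<sigma> \<delta> S' \<and> good_for \<sigma> \<delta> \<iota> a S' \<and> S_inj \<subseteq> S' \<longrightarrow> S' = S_inj)"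
    using S_inj_left_ore S_inj_good good_subset_S_inj by blast
next
  fix S assume "left_ore \<sigma> \<delta> S \<and> good_for \<sigma> \<delta> \<iota> a S \<and>
      (\<forall>S'. left_ore \<sigma> \<delta> S' \<and> good_for \<sigma> \<delta> \<iota> a S' \<and> S \<subseteq> S' \<longrightarrow> S' = S)"
  then show "S = S_inj"
    using S_inj_left_ore S_inj_good good_subset_S_inj by blast
qed

lemma fractions_S_inj:
  "{inverse (\<iota> s) * \<iota> r | s r. s \<in> S_inj \<and> r \<in> skew_polys} = Def_at \<sigma> \<delta> \<iota> a"
proof (intro equalityI subsetI)
  fix f assume "f \<in> {inverse (\<iota> s) * \<iota> r | s r. s \<in> S_inj \<and> r \<in> skew_polys}"
  then obtain s r where f: "f = inverse (\<iota> s) * \<iota> r" and s: "s \<in> S_inj" and r: "r \<in> skew_polys"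
    by blast
  have sR: "s \<in> skew_polys" "inj (act (\<iota> s))" "\<iota> s \<noteq> 0"
    using s S_inj_nonzero iota_eq_zero_iff unfolding S_inj_def by auto
  then have "\<iota> s * f = \<iota> r"
    unfolding f by (simp add: mult.assoc[symmetric])
  then show "f \<in> Def_at \<sigma> \<delta> \<iota> a"
    unfolding Def_at_iff using sR r iota_polys by metis
next
  fix f assume "f \<in> Def_at \<sigma> \<delta> \<iota> a"
  then obtain u where u: "u \<in> polys" "inj (act u)" "u * f \<in> polys"
    unfolding Def_at_iff by blast
  obtain s r where s: "s \<in> skew_polys" "u = \<iota> s" and r: "r \<in> skew_polys" "u * f = \<iota> r"
    using u(1,3) by (meson polysE)
  have S: "s \<in> S_inj"
    unfolding S_inj_def using s u by simp
  then have "\<iota> s \<noteq> 0"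
    using S_inj_nonzero iota_eq_zero_iff s by blast
  then have "f = inverse (\<iota> s) * \<iota> r"
    unfolding r(2)[symmetric] s(2) by (simp add: mult.assoc[symmetric])
  then show "f \<in> {inverse (\<iota> s) * \<iota> r | s r. s \<in> S_inj \<and> r \<in> skew_polys}"
    using S r by blast
qed

end

theorem theorem3p10:
  fixes \<sigma> \<delta> :: "'a::division_ring \<Rightarrow> 'a"
    and \<iota> :: "(nat \<Rightarrow> 'a) \<Rightarrow> 'd::division_ring"
    and a :: 'a
  assumes "ring_endo \<sigma>"
    and "sigma_derivation \<sigma> \<delta>"
    and "left_frac_ring \<sigma> \<delta> \<iota>"
    and "sd_algebraic \<sigma> \<delta> (conj_class \<sigma> \<delta> a)"
  shows "(\<forall>P\<in>skew_polys. P \<noteq> spzero \<longrightarrow>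
            (P \<in> S_at \<sigma> \<delta> \<iota> a \<longleftrightarrow> (\<forall>c\<in>conj_class \<sigma> \<delta> a. speval \<sigma> \<delta> P c \<noteq> 0)))
       \<and> {inverse (\<iota> s) * \<iota> r | s r. s \<in> S_at \<sigma> \<delta> \<iota> a \<and> r \<in> skew_polys} = Def_at \<sigma> \<delta> \<iota> a"
proof -
  interpret skew_fraction_algebraic \<sigma> \<delta> \<iota> a
    using assms by unfold_locales
  show ?thesis
    using speval_nonvanishing_iff fractions_S_inj unfolding S_at_eq by (auto simp: S_inj_def)
qed

end
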